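(* The map $\zeta^T_{\mathrm{sh}}:\mathcal{PT}^{\mathrm{conv}}_{\{x,y\}}\to\mathbb R$ is an algebra morphism for the dendriform shuffle product $\mathrm{sh}^T$, and the map $\zeta^T:\mathcal{PT}^{\mathrm{conv}}_{\mathbb N^*}\to\mathbb R$ is an algebra morphism for the tridendriform quasi-shuffle product $\mathrm{qsh}^T$. That is, $$\zeta^T_{\mathrm{sh}}(S\mathbin{\mathrm{sh}^T}T)=\zeta^T_{\mathrm{sh}}(S)\,\zeta^T_{\mathrm{sh}}(T)\quad\text{for all }S,T\in\mathcal{PT}^{\mathrm{conv}}_{\{x,y\}},$$ $$\zeta^T(S\mathbin{\mathrm{qsh}^T}T)=\zeta^T(S)\,\zeta^T(T)\quad\text{for all }S,T\in\mathcal{PT}^{\mathrm{conv}}_{\mathbb N^*}.$$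
   Context: $\mathbb K$ is a subfield of $\mathbb R$ (e.g. $\mathbb Q$); $\mathbb N^*=\{1,2,3,\dots\}$ with its addition. A planar rooted tree is a finite rooted tree in which the children of every vertex are linearly ordered. For a set $\Omega$, $\mathrm{PT}_\Omega$ is the set of non-empty planar rooted trees with vertices decorated by $\Omega$, and $\mathcal{PT}_\Omega$ the $\mathbb K$-vector space with basis $\mathrm{PT}_\Omega$. The vertex set $V(t)$ of a tree is partially ordered with the root as minimum ($u\le v$ iff $u$ lies on the path from the root to $v$); leaves are the maximal vertices. $B_+^a(T_1\cdots T_k)$ is the tree obtained by grafting $T_1,\dots,T_k$ in this order on a new root decorated by $a$ (extended multilinearly); $B_+^a(\emptyset)$ is the one-vertex tree. Tree products. For $S=B_+^a(S_1\cdots S_k)$, $T=B_+^b(T_1\cdots T_\ell)$, $k,\ell\ge0$, define by induction on the total number of vertices and bilinearity $S<T:=B_+^a(S_1\cdots S_{k-1}(S_k\ast T))$ if $k\ge1$, $B_+^a(T)$ if $k=0$; $S>T:=B_+^b((S\ast T_1)T_2\cdots T_\ell)$ if $\ell\ge1$, $B_+^b(S)$ if $\ell=0$; $S\bullet T:=B_+^{a+b}(S_1\cdots S_{k-1}(S_k\ast T_1)T_2\cdots T_\ell)$ if $k,\ell\ge1$, $B_+^{a+b}(T_1\cdots T_\ell)$ if $k=0$, $B_+^{a+b}(S_1\cdots S_k)$ if $\ell=0$. On $\mathcal{PT}_{\{x,y\}}$, $\ast=\mathrm{sh}^T:={<}+{>}$ (no product $\bullet$). On $\mathcal{PT}_{\mathbb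 N^*}$, $\ast=\mathrm{qsh}^T:={<}+{>}+\bullet$. Arborified zeta values. $\mathcal{PT}^{\mathrm{conv}}_{\mathbb N^*}$ is the subspace of $\mathcal{PT}_{\mathbb N^*}$ spanned by trees whose root is not decorated by $1$; for such a tree $t$ with vertex decorations $(n_v)_{v\in V(t)}$, $$\zeta^T(t):=\sum_{(k_v)\in D_t}\ \prod_{v\in V(t)}\frac1{k_v^{n_v}},\qquad D_t:=\{(k_v)_{v\in V(t)}\in(\mathbb N^* )^{V(t)}: k_v<k_u\text{ whenever }u<v\}.$$ $\mathcal{PT}^{\mathrm{conv}}_{\{x,y\}}$ is the subspace of $\mathcal{PT}_{\{x,y\}}$ spanned by trees whose root is decorated by $x$ and all of whose leaves are decorated by $y$; for such a tree $t$ with decorations $(d_v)_{v\in V(t)}$, $$\zeta^T_{\mathrm{sh}}(t):=\int_{\Delta_t}\ \prod_{v\in V(t)}g_{d_v}(t_v)\,dt_v,\qquad \Delta_t:=\{(t_v)_{v\in V(t)}\in[0,1]^{V(t)}: t_u>t_v\text{ whenever }u<v\},$$ with $g_x(\tau)=1/\tau$, $g_y(\tau)=1/(1-\tau)$ on $(0,1)$. These series and integrals converge, and both maps are extended linearly. The two subspaces are stable under $\mathrm{qsh}^T$ and $\mathrm{sh}^T$ respectively. *)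

theory Defs
  imports "HOL-Analysis.Analysis" "HOL-Library.Poly_Mapping" "HOL-Library.Sublist"
begin

section \<open>Planar rooted trees and their vertices\<close>

text \<open>Trees decorated by a set \<open>\<Omega>\<close> are those with \<open>labels t \<subseteq> \<Omega>\<close>.\<close>

datatype (labels: 'a) ptree = Node (root: 'a) (children: "'a ptree list")

text \<open>A vertex is addressed by the list of child indices leading to it from the root, so that
  the tree order (\<open>u \<le> v\<close> iff \<open>u\<close> lies on the path from the root to \<open>v\<close>) is the prefix order.\<close>

primrec is_vertex :: "nat list \<Rightarrow> 'a ptree \<Rightarrow> bool" where
  "is_vertex [] t = True"
| "is_vertex (i # p) t = (i < length (children t) \<and> is_vertex p (children t ! i))"

definition verts :: "'a ptree \<Rightarrow> nat list set" where
  "verts t = {p. is_vertex p t}"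

primrec deco_at :: "nat list \<Rightarrow> 'a ptree \<Rightarrow> 'a" where
  "deco_at [] t = root t"
| "deco_at (i # p) t = deco_at p (children t ! i)"

abbreviation deco :: "'a ptree \<Rightarrow> nat list \<Rightarrow> 'a" where
  "deco t v \<equiv> deco_at v t"

definition leaves :: "'a ptree \<Rightarrow> nat list set" where
  "leaves t = {v \<in> verts t. \<not> (\<exists>w \<in> verts t. strict_prefix v w)}"


section \<open>Linear combinations of trees over a subfield of the reals\<close>

definition real_subfield :: "real set \<Rightarrow> bool" where
  "real_subfield K \<longleftrightarrow> 0 \<in> K \<and> 1 \<in> K \<and>
     (\<forall>a\<in>K. \<forall>b\<in>K. a + b \<in> K \<and> a * b \<in> K) \<and> (\<forall>a\<in>K. - a \<in> K \<and> inverse a \<in> K)"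

type_synonym 'a tree_comb = "'a ptree \<Rightarrow>\<^sub>0 real"

abbreviation tree_basis :: "'a ptree \<Rightarrow> 'a tree_comb" where
  "tree_basis t \<equiv> Poly_Mapping.single t 1"

definition scal :: "real \<Rightarrow> 'a tree_comb \<Rightarrow> 'a tree_comb" where
  "scal c p = Poly_Mapping.map ((*) c) p"

text \<open>The \<open>K\<close>-span of a set \<open>B\<close> of trees.\<close>

definition tree_span :: "real set \<Rightarrow> 'a ptree set \<Rightarrow> 'a tree_comb set" where
  "tree_span K B = {p. (\<forall>t. Poly_Mapping.lookup p t \<in> K) \<and> Poly_Mapping.keys p \<subseteq> B}"

definition lin_ext :: "('a ptree \<Rightarrow> 'b tree_comb) \<Rightarrow> 'a tree_comb \<Rightarrow> 'b tree_comb" where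
  "lin_ext f p = (\<Sum>t\<in>Poly_Mapping.keys p. scal (Poly_Mapping.lookup p t) (f t))"

definition bilin_ext ::
    "('a ptree \<Rightarrow> 'a ptree \<Rightarrow> 'a tree_comb) \<Rightarrow> 'a tree_comb \<Rightarrow> 'a tree_comb \<Rightarrow> 'a tree_comb" where
  "bilin_ext f p q = lin_ext (\<lambda>s. lin_ext (f s) q) p"

definition real_lin_ext :: "('a ptree \<Rightarrow> real) \<Rightarrow> 'a tree_comb \<Rightarrow> real" where
  "real_lin_ext f p = (\<Sum>t\<in>Poly_Mapping.keys p. Poly_Mapping.lookup p t * f t)"


section \<open>The dendriform shuffle and tridendriform quasi-shuffle products\<close>

text \<open>\<open>graft a us p vs\<close> is \<open>B\<^sub>+\<^sup>a(us p vs)\<close>, extended linearly in \<open>p\<close>.\<close>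

definition graft ::
    "'a \<Rightarrow> 'a ptree list \<Rightarrow> 'a tree_comb \<Rightarrow> 'a ptree list \<Rightarrow> 'a tree_comb" where
  "graft a us p vs = lin_ext (\<lambda>w. tree_basis (Node a (us @ w # vs))) p"

text \<open>The products on basis trees. The first argument \<open>m\<close> tells which product \<open>*\<close> is used in the
  recursion: for \<open>m = None\<close> it is \<open>{<} + {>}\<close>, and for \<open>m = Some f\<close> it is \<open>{<} + {>} + \<bullet>\<close>,
  where \<open>\<bullet>\<close> combines the root decorations by \<open>f\<close>.\<close>

function (sequential)
  tree_lt :: "('a \<Rightarrow> 'a \<Rightarrow> 'a) option \<Rightarrow> 'a ptree \<Rightarrow> 'a ptree \<Rightarrow> 'a tree_comb" and
  tree_gt :: "('a \<Rightarrow> 'a \<Rightarrow> 'a) option \<Rightarrow> 'a ptree \<Rightarrow> 'a ptree \<Rightarrow> 'a tree_comb" and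
  tree_bullet :: "('a \<Rightarrow> 'a \<Rightarrow> 'a) \<Rightarrow> 'a ptree \<Rightarrow> 'a ptree \<Rightarrow> 'a tree_comb" and
  tree_star :: "('a \<Rightarrow> 'a \<Rightarrow> 'a) option \<Rightarrow> 'a ptree \<Rightarrow> 'a ptree \<Rightarrow> 'a tree_comb"
where
  "tree_lt m (Node a ss) t =
     (if ss = [] then tree_basis (Node a [t])
      else graft a (butlast ss) (tree_star m (last ss) t) [])"
| "tree_gt m s (Node b ts) =
     (if ts = [] then tree_basis (Node b [s])
      else graft b [] (tree_star m s (hd ts)) (tl ts))"
| "tree_bullet f (Node a ss) (Node b ts) =
     (if ss = [] then tree_basis (Node (f a b) ts)
      else if ts = [] then tree_basis (Node (f a b) ss)
      else graft (f a b) (butlast ss) (tree_star (Some f) (last ss) (hd ts)) (tl ts))"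
| "tree_star m s t =
     tree_lt m s t + tree_gt m s t + (case m of None \<Rightarrow> 0 | Some f \<Rightarrow> tree_bullet f s t)"
  by pat_completeness auto

lemma size_children_less: "t \<in> set ts \<Longrightarrow> size t < size (Node a ts)"
  by (induction ts) auto

termination
proof (relation "Wellfounded.measure (\<lambda>z. case z of
      Inl (Inl (m, s, t)) \<Rightarrow> 2 * (size s + size t)
    | Inl (Inr (m, s, t)) \<Rightarrow> 2 * (size s + size t)
    | Inr (Inl (f, s, t)) \<Rightarrow> 2 * (size s + size t)
    | Inr (Inr (m, s, t)) \<Rightarrow> 2 * (size s + size t) + 1)", goal_cases)
  case (2 m a ss t)
  then show ?case using size_children_less[of "last ss" ss a] by simp
next
  case (3 m s b ts)
  then show ?case using size_children_less[of "hd ts" ts b] by simp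
next
  case (4 f a ss b ts)
  then show ?case
    using size_children_less[of "last ss" ss a] size_children_less[of "hd ts" ts b] by simp
qed auto

definition shT :: "'a tree_comb \<Rightarrow> 'a tree_comb \<Rightarrow> 'a tree_comb" where
  "shT = bilin_ext (tree_star None)"

definition qshT :: "nat tree_comb \<Rightarrow> nat tree_comb \<Rightarrow> nat tree_comb" where
  "qshT = bilin_ext (tree_star (Some (+)))"


section \<open>Arborified zeta values\<close>

subsection \<open>Series\<close>

definition conv_trees_nat :: "nat ptree set" where
  "conv_trees_nat = {t. labels t \<subseteq> {1..} \<and> root t \<noteq> 1}"

text \<open>Families indexed by \<open>verts t\<close> are extensional functions.\<close>

definition zeta_domain :: "nat ptree \<Rightarrow> (nat list \<Rightarrow> nat) set" where
  "zeta_domain t = {k \<in> verts t \<rightarrow>\<^sub>E {1..}.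
     \<forall>u\<in>verts t. \<forall>v\<in>verts t. strict_prefix u v \<longrightarrow> k v < k u}"

definition zeta_tree :: "nat ptree \<Rightarrow> real" where
  "zeta_tree t = (\<Sum>\<^sub>\<infinity>k\<in>zeta_domain t. \<Prod>v\<in>verts t. 1 / real (k v) ^ deco t v)"

definition zetaT :: "nat tree_comb \<Rightarrow> real" where
  "zetaT = real_lin_ext zeta_tree"

subsection \<open>Integrals\<close>

datatype letter = Lx | Ly

definition conv_trees_letter :: "letter ptree set" where
  "conv_trees_letter = {t. root t = Lx \<and> (\<forall>v\<in>leaves t. deco t v = Ly)}"

text \<open>The value \<open>1 / 0 = 0\<close> at the endpoints of \<open>[0,1]\<close> only concerns a null set of the
  domain of integration.\<close>

fun form_density :: "letter \<Rightarrow> real \<Rightarrow> real" where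
  "form_density Lx \<tau> = 1 / \<tau>"
| "form_density Ly \<tau> = 1 / (1 - \<tau>)"

definition tree_simplex :: "'a ptree \<Rightarrow> (nat list \<Rightarrow> real) set" where
  "tree_simplex t = {z \<in> verts t \<rightarrow>\<^sub>E {0..1}.
     \<forall>u\<in>verts t. \<forall>v\<in>verts t. strict_prefix u v \<longrightarrow> z u > z v}"

definition zeta_sh_tree :: "letter ptree \<Rightarrow> real" where
  "zeta_sh_tree t =
     (LINT z : tree_simplex t | Pi\<^sub>M (verts t) (\<lambda>_. lborel). \<Prod>v\<in>verts t. form_density (deco t v) (z v))"

definition zeta_shT :: "letter tree_comb \<Rightarrow> real" where
  "zeta_shT = real_lin_ext zeta_sh_tree"


section \<open>Algebra morphisms to the reals\<close>

text \<open>\<open>A\<close> is a \<open>K\<close>-subspace stable under the (bilinear) product \<open>m\<close>, and \<open>f\<close> restricted to \<open>A\<close> is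
  \<open>K\<close>-linear and multiplicative. No unit is involved: all trees are non-empty.\<close>

definition algebra_morphism ::
    "real set \<Rightarrow> 'a tree_comb set \<Rightarrow> ('a tree_comb \<Rightarrow> 'a tree_comb \<Rightarrow> 'a tree_comb) \<Rightarrow>
     ('a tree_comb \<Rightarrow> real) \<Rightarrow> bool" where
  "algebra_morphism K A m f \<longleftrightarrow>
     0 \<in> A \<and> (\<forall>S\<in>A. \<forall>T\<in>A. S + T \<in> A \<and> m S T \<in> A) \<and> (\<forall>c\<in>K. \<forall>S\<in>A. scal c S \<in> A) \<and>
     (\<forall>S\<in>A. \<forall>T\<in>A. f (S + T) = f S + f T) \<and> (\<forall>c\<in>K. \<forall>S\<in>A. f (scal c S) = c * f S) \<and>
     (\<forall>S\<in>A. \<forall>T\<in>A. f (m S T) = f S * f T)"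

end

theory Submission
  imports Defs
begin

text \<open>Both zeta functions are instances of one iterated integral
  \<open>I t X = \<integral>\<^sub>X w (root t) s * (\<Prod>c. I c {..<s}) ds\<close> (\<open>c\<close> a child of the root) with respect to a
  measure on a linear order, evaluated at \<open>X = UNIV\<close>: counting measure with weights \<open>1 / k ^ n\<close>, or
  Lebesgue measure on \<open>[0,1]\<close> with the two differential forms. In \<open>I S X * I T X\<close> the two root variables
  satisfy \<open>s > r\<close>, \<open>s < r\<close> or \<open>s = r\<close>. By Fubini and induction the first two regions give \<open>S < T\<close> and
  \<open>S > T\<close>; the diagonal gives \<open>S \<bullet> T\<close> for the counting measure, as the weights are multiplicative in
  \<open>n\<close>, and it is a null set for Lebesgue measure. The identity is proved for extended nonnegative
  integrals; it transfers to the reals because partial integrals of convergent trees grow at most like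
  a power of the logarithm.\<close>

section \<open>Linear combinations of trees\<close>

lemma lookup_scal [simp]: "Poly_Mapping.lookup (scal c p) t = c * Poly_Mapping.lookup p t"
  by (simp add: scal_def Poly_Mapping.map.rep_eq when_def)

text \<open>The defining sum runs over the support, which varies with the combination. Coefficients
  vanish outside it, so any finite superset will do, and \<open>p\<close>, \<open>q\<close> and
  \<open>p + q\<close> can be summed over one common index set.\<close>

lemma lin_ext_superset:
  assumes "finite A" "Poly_Mapping.keys p \<subseteq> A"
  shows "lin_ext f p = (\<Sum>t\<in>A. scal (Poly_Mapping.lookup p t) (f t))"
  unfolding lin_ext_def using assms
  by (intro sum.mono_neutral_left) (auto intro!: poly_mapping_eqI simp: in_keys_iff)

lemma real_lin_ext_superset:
  assumes "finite A" "Poly_Mapping.keys p \<subseteq> A"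
  shows "real_lin_ext f p = (\<Sum>t\<in>A. Poly_Mapping.lookup p t * f t)"
  unfolding real_lin_ext_def using assms
  by (intro sum.mono_neutral_left) (auto simp: in_keys_iff)

lemma lin_ext_add: "lin_ext f (p + q) = lin_ext f p + lin_ext f q"
proof -
  let ?A = "Poly_Mapping.keys p \<union> Poly_Mapping.keys q"
  have "lin_ext f r = (\<Sum>t\<in>?A. scal (Poly_Mapping.lookup r t) (f t))"
    if "Poly_Mapping.keys r \<subseteq> ?A" for r
    using that by (intro lin_ext_superset) auto
  note * = this
  show ?thesis
    using keys_add[of p q]
    by (subst (1 2 3) *)
      (auto intro!: poly_mapping_eqI
        simp: lookup_add lookup_sum sum.distrib[symmetric] algebra_simps)
qed

lemma lin_ext_zero [simp]: "lin_ext f 0 = 0"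
  by (simp add: lin_ext_def)

lemma lin_ext_tree_basis [simp]: "lin_ext f (tree_basis t) = f t"
  by (simp add: lin_ext_def) (auto intro!: poly_mapping_eqI)

lemma real_lin_ext_add: "real_lin_ext f (p + q) = real_lin_ext f p + real_lin_ext f q"
proof -
  let ?A = "Poly_Mapping.keys p \<union> Poly_Mapping.keys q"
  have "real_lin_ext f r = (\<Sum>t\<in>?A. Poly_Mapping.lookup r t * f t)"
    if "Poly_Mapping.keys r \<subseteq> ?A" for r
    using that by (intro real_lin_ext_superset) auto
  note * = this
  show ?thesis
    using keys_add[of p q]
    by (subst (1 2 3) *) (auto simp: lookup_add sum.distrib[symmetric] algebra_simps)
qed

lemma keys_scal: "Poly_Mapping.keys (scal c p) \<subseteq> Poly_Mapping.keys p"
  by (auto simp: in_keys_iff)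

lemma real_lin_ext_scal: "real_lin_ext f (scal c p) = c * real_lin_ext f p"
  using real_lin_ext_superset[OF finite_keys keys_scal, of f c p]
  by (simp add: real_lin_ext_def sum_distrib_left algebra_simps)

lemma real_lin_ext_zero [simp]: "real_lin_ext f 0 = 0"
  by (simp add: real_lin_ext_def)

lemma real_lin_ext_tree_basis [simp]: "real_lin_ext f (tree_basis t) = f t"
  by (simp add: real_lin_ext_def)

lemma real_lin_ext_sum: "real_lin_ext f (\<Sum>i\<in>I. p i) = (\<Sum>i\<in>I. real_lin_ext f (p i))"
  by (induction I rule: infinite_finite_induct) (auto simp: real_lin_ext_add)

lemma real_lin_ext_lin_ext:
  "real_lin_ext f (lin_ext g p) = (\<Sum>t\<in>Poly_Mapping.keys p. Poly_Mapping.lookup p t * real_lin_ext f (g t))"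
  by (simp add: lin_ext_def real_lin_ext_sum real_lin_ext_scal)

lemma real_lin_ext_bilin_ext:
  assumes "\<And>s t. s \<in> Poly_Mapping.keys p \<Longrightarrow> t \<in> Poly_Mapping.keys q \<Longrightarrow>
    real_lin_ext f (g s t) = f s * f t"
  shows "real_lin_ext f (bilin_ext g p q) = real_lin_ext f p * real_lin_ext f q"
proof -
  have "real_lin_ext f (bilin_ext g p q) = (\<Sum>s\<in>Poly_Mapping.keys p. \<Sum>t\<in>Poly_Mapping.keys q.
    (Poly_Mapping.lookup p s * f s) * (Poly_Mapping.lookup q t * f t))"
    by (simp add: bilin_ext_def real_lin_ext_lin_ext assms sum_distrib_left algebra_simps)
  then show ?thesis
    by (simp only: sum_product real_lin_ext_def)
qed

text \<open>Turns grafting, the only linear extension in the recursion of the products, into a map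
  over a list of trees; the recursion of \<open>tree_star\<close> then becomes a recursion on
  lists.\<close>

lemma graft_sum_list:
  "graft a us (sum_list (map tree_basis xs)) vs =
   sum_list (map tree_basis (map (\<lambda>w. Node a (us @ w # vs)) xs))"
  by (induction xs) (auto simp: graft_def lin_ext_add)

lemma real_lin_ext_sum_list:
  "real_lin_ext f (sum_list (map tree_basis xs)) = sum_list (map f xs)"
  by (induction xs) (auto simp: real_lin_ext_add)

section \<open>Spans of sets of trees and their stability\<close>

lemma zero_in_tree_span: "real_subfield K \<Longrightarrow> 0 \<in> tree_span K B"
  by (simp add: tree_span_def real_subfield_def)

lemma add_in_tree_span:
  "real_subfield K \<Longrightarrow> p \<in> tree_span K B \<Longrightarrow> q \<in> tree_span K B \<Longrightarrow> p + q \<in> tree_span K B"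
  using keys_add[of p q] by (auto simp: tree_span_def real_subfield_def lookup_add)

lemma scal_in_tree_span:
  "real_subfield K \<Longrightarrow> c \<in> K \<Longrightarrow> p \<in> tree_span K B \<Longrightarrow> scal c p \<in> tree_span K B"
  using keys_scal[of c p] by (auto simp: tree_span_def real_subfield_def)

lemma tree_basis_in_tree_span: "real_subfield K \<Longrightarrow> t \<in> B \<Longrightarrow> tree_basis t \<in> tree_span K B"
  by (auto simp: tree_span_def real_subfield_def lookup_single when_def)

lemma sum_list_in_tree_span:
  "real_subfield K \<Longrightarrow> set xs \<subseteq> B \<Longrightarrow> sum_list (map tree_basis xs) \<in> tree_span K B"
  by (induction xs) (auto intro: zero_in_tree_span add_in_tree_span tree_basis_in_tree_span)

lemma sum_in_tree_span:
  "real_subfield K \<Longrightarrow> (\<And>i. i \<in> I \<Longrightarrow> p i \<in> tree_span K B) \<Longrightarrow> (\<Sum>i\<in>I. p i) \<in> tree_span K B"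
  by (induction I rule: infinite_finite_induct) (auto intro: zero_in_tree_span add_in_tree_span)

lemma lin_ext_in_tree_span:
  assumes "real_subfield K" "p \<in> tree_span K A" "\<And>t. t \<in> A \<Longrightarrow> f t \<in> tree_span K B"
  shows "lin_ext f p \<in> tree_span K B"
  unfolding lin_ext_def using assms
  by (intro sum_in_tree_span scal_in_tree_span) (auto simp: tree_span_def)

section \<open>Expansion of the products on trees\<close>

text \<open>The coefficients of the product \<open>*\<close> of two trees are natural numbers. Listing its trees with
  multiplicity lets it be evaluated in the extended nonnegative reals.\<close>

function star_list :: "('a \<Rightarrow> 'a \<Rightarrow> 'a) option \<Rightarrow> 'a ptree \<Rightarrow> 'a ptree \<Rightarrow> 'a ptree list" where
  "star_list m (Node a ss) (Node b ts) =
     map (Node a) (if ss = [] then [[Node b ts]]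
       else map (\<lambda>w. butlast ss @ [w]) (star_list m (last ss) (Node b ts))) @
     map (Node b) (if ts = [] then [[Node a ss]]
       else map (\<lambda>w. w # tl ts) (star_list m (Node a ss) (hd ts))) @
     (case m of None \<Rightarrow> [] | Some f \<Rightarrow>
       map (Node (f a b)) (if ss = [] then [ts] else if ts = [] then [ss]
         else map (\<lambda>w. butlast ss @ w # tl ts) (star_list m (last ss) (hd ts))))"
  by pat_completeness auto

termination
proof (relation "Wellfounded.measure (\<lambda>(m, s, t). size s + size t)", goal_cases)
  case (2 m a ss b ts)
  then show ?case using size_children_less[of "last ss" ss a] by simp
next
  case (3 m a ss b ts)
  then show ?case using size_children_less[of "hd ts" ts b] by simp
next
  case (4 m a ss b ts)
  then show ?case
    using size_children_less[of "last ss" ss a] size_children_less[of "hd ts" ts b] by simp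
qed auto

declare star_list.simps [simp del] tree_star.simps [simp del]

lemma tree_star_eq_sum_list: "tree_star m s t = sum_list (map tree_basis (star_list m s t))"
proof (induction m s t rule: star_list.induct)
  case (1 m a ss b ts)
  show ?case
    using 1 by (cases m; cases "ss = []"; cases "ts = []")
      (simp_all add: star_list.simps tree_star.simps graft_sum_list o_def)
qed

lemma bilin_ext_tree_star_in_tree_span:
  assumes "real_subfield K" "p \<in> tree_span K B" "q \<in> tree_span K B"
    and "\<And>s t. s \<in> B \<Longrightarrow> t \<in> B \<Longrightarrow> set (star_list m s t) \<subseteq> B"
  shows "bilin_ext (tree_star m) p q \<in> tree_span K B"
  unfolding bilin_ext_def
  by (rule lin_ext_in_tree_span[OF assms(1,2)], rule lin_ext_in_tree_span[OF assms(1,3)])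
    (auto simp: tree_star_eq_sum_list intro!: sum_list_in_tree_span assms(1) dest: assms(4))

text \<open>By bilinearity everything reduces to pairs of basis trees: the set \<open>B\<close> must
  be closed under the expansion of the product, and \<open>f\<close> multiplicative on it. Any
  subfield \<open>K\<close> is allowed because the expansion has natural numbers as
  coefficients.\<close>

lemma algebra_morphism_tree_star:
  assumes K: "real_subfield K"
    and closed: "\<And>s t. s \<in> B \<Longrightarrow> t \<in> B \<Longrightarrow> set (star_list m s t) \<subseteq> B"
    and mult: "\<And>s t. s \<in> B \<Longrightarrow> t \<in> B \<Longrightarrow> sum_list (map f (star_list m s t)) = f s * f t"
  shows "algebra_morphism K (tree_span K B) (bilin_ext (tree_star m)) (real_lin_ext f)"
proof -
  have "real_lin_ext f (bilin_ext (tree_star m) p q) = real_lin_ext f p * real_lin_ext f q"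
    if "p \<in> tree_span K B" "q \<in> tree_span K B" for p q
    by (rule real_lin_ext_bilin_ext, unfold tree_star_eq_sum_list real_lin_ext_sum_list, rule mult)
      (use that in \<open>auto simp: tree_span_def\<close>)
  with closed show ?thesis
    by (auto simp: algebra_morphism_def real_lin_ext_add real_lin_ext_scal
        intro!: K zero_in_tree_span add_in_tree_span scal_in_tree_span
          bilin_ext_tree_star_in_tree_span)
qed

section \<open>Properties inherited by the trees of a product\<close>

text \<open>One case for each way in which a tree arises in the expansion. The patterns
  \<open>ss @ [s]\<close> and \<open>t # ts\<close> replace \<open>last\<close>,
  \<open>butlast\<close>, \<open>hd\<close> and \<open>tl\<close>, so that invariants of the
  products follow by simplification.\<close>

lemma star_list_elem_induct [consumes 1, case_names lt_leaf lt gt_leaf gt bullet_leaf1 bullet_leaf2 bullet]: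
  assumes "u \<in> set (star_list m s t)"
    and "\<And>a t. P (Node a []) t (Node a [t])"
    and "\<And>a ss s t w. w \<in> set (star_list m s t) \<Longrightarrow> P s t w \<Longrightarrow> P (Node a (ss @ [s])) t (Node a (ss @ [w]))"
    and "\<And>s b. P s (Node b []) (Node b [s])"
    and "\<And>s b t ts w. w \<in> set (star_list m s t) \<Longrightarrow> P s t w \<Longrightarrow> P s (Node b (t # ts)) (Node b (w # ts))"
    and "\<And>f a b ts. m = Some f \<Longrightarrow> P (Node a []) (Node b ts) (Node (f a b) ts)"
    and "\<And>f a b ss. m = Some f \<Longrightarrow> P (Node a ss) (Node b []) (Node (f a b) ss)"
    and "\<And>f a b ss s t ts w. m = Some f \<Longrightarrow> w \<in> set (star_list m s t) \<Longrightarrow> P s t w \<Longrightarrow>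
      P (Node a (ss @ [s])) (Node b (t # ts)) (Node (f a b) (ss @ w # ts))"
  shows "P s t u"
proof -
  \<comment> \<open>The functional induction varies its first argument; the equation
    \<open>m' = m\<close> carries the assumptions about the fixed \<open>m\<close> through
    it.\<close>
  have "P s t u" if "u \<in> set (star_list m' s t)" "m' = m" for m'
    using that
  proof (induction m' s t arbitrary: u rule: star_list.induct)
    case (1 m' a ss b ts)
    note IH = "1.IH" and prem = "1.prems"
    consider (lt_leaf) "ss = []" "u = Node a [Node b ts]"
      | (lt) ss' s w where "ss = ss' @ [s]" "w \<in> set (star_list m' s (Node b ts))" "u = Node a (ss' @ [w])"
      | (gt_leaf) "ts = []" "u = Node b [Node a ss]"
      | (gt) t ts' w where "ts = t # ts'" "w \<in> set (star_list m' (Node a ss) t)" "u = Node b (w # ts')"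
      | (bullet_leaf1) f where "m' = Some f" "ss = []" "u = Node (f a b) ts"
      | (bullet_leaf2) f where "m' = Some f" "ts = []" "u = Node (f a b) ss"
      | (bullet) f ss' s t ts' w where "m' = Some f" "ss = ss' @ [s]" "ts = t # ts'"
          "w \<in> set (star_list m' s t)" "u = Node (f a b) (ss' @ w # ts')"
    proof -
      have "u \<in> set (map (Node a) (if ss = [] then [[Node b ts]]
          else map (\<lambda>w. butlast ss @ [w]) (star_list m' (last ss) (Node b ts)))) \<or>
        u \<in> set (map (Node b) (if ts = [] then [[Node a ss]]
          else map (\<lambda>w. w # tl ts) (star_list m' (Node a ss) (hd ts)))) \<or>
        (\<exists>f. m' = Some f \<and> u \<in> set (map (Node (f a b)) (if ss = [] then [ts] else if ts = [] then [ss]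
          else map (\<lambda>w. butlast ss @ w # tl ts) (star_list m' (last ss) (hd ts)))))"
        using prem(1) unfolding star_list.simps
        by (cases m') (auto simp del: set_map split del: if_split)
      then show thesis
      proof (elim disjE exE conjE, goal_cases)
        case 1
        then show ?case
          by (cases ss rule: rev_cases) (auto intro: lt_leaf lt)
      next
        case 2
        then show ?case
          by (cases ts) (auto intro: gt_leaf gt)
      next
        case (3 f)
        then show ?case
          by (cases ss rule: rev_cases; cases ts) (auto intro: bullet_leaf1 bullet_leaf2 bullet)
      qed
    qed
    then show ?case
    proof cases
      case lt_leaf
      then show ?thesis using assms(2) by simp
    next
      case lt
      then show ?thesis using IH(1) assms(3) prem(2) by simp
    next
      case gt_leaf
      then show ?thesis using assms(4) by simp
    next
      case gt
      then show ?thesis using IH(2) assms(5) prem(2) by simp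
    next
      case bullet_leaf1
      then show ?thesis using assms(6) prem(2) by simp
    next
      case bullet_leaf2
      then show ?thesis using assms(7) prem(2) by simp
    next
      case bullet
      then show ?thesis using IH(3) assms(8) prem(2) by simp
    qed
  qed
  from this[OF assms(1) refl] show ?thesis .
qed

lemma labels_star_list:
  assumes "u \<in> set (star_list m s t)" "labels s \<subseteq> L" "labels t \<subseteq> L"
    and "\<And>f a b. m = Some f \<Longrightarrow> a \<in> L \<Longrightarrow> b \<in> L \<Longrightarrow> f a b \<in> L"
  shows "labels u \<subseteq> L"
  using assms(1-3) by (induction rule: star_list_elem_induct) (use assms(4) in auto)

lemma root_star_list:
  assumes "u \<in> set (star_list m s t)"
  shows "root u = root s \<or> root u = root t \<or> (\<exists>f. m = Some f \<and> root u = f (root s) (root t))"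
  using assms by (induction rule: star_list_elem_induct) auto

text \<open>The decorations of the leaves by structural recursion, for inductions in which vertex
  addresses would be a burden.\<close>

primrec leaf_labels :: "'a ptree \<Rightarrow> 'a set" where
  "leaf_labels (Node a ts) = (if ts = [] then {a} else \<Union> (set (map leaf_labels ts)))"

text \<open>No new leaf arises: a childless root that receives the other factor stops being a leaf,
  and every other leaf keeps its decoration.\<close>

lemma leaf_labels_star_list:
  assumes "u \<in> set (star_list None s t)"
  shows "leaf_labels u \<subseteq> leaf_labels s \<union> leaf_labels t"
  using assms by (induction rule: star_list_elem_induct) auto

section \<open>Vertices\<close>

lemma verts_Node: "verts (Node a ts) = insert [] (\<Union>i<length ts. (#) i ` verts (ts ! i))"
proof -
  have "p \<in> verts (Node a ts) \<longleftrightarrow> p = [] \<or> (\<exists>i<length ts. p \<in> (#) i ` verts (ts ! i))" for p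
    by (cases p) (auto simp: verts_def)
  then show ?thesis by blast
qed

lemma Nil_in_verts [simp]: "[] \<in> verts t"
  by (simp add: verts_def)

lemma finite_verts [simp]: "finite (verts t)"
proof (induction t)
  case (Node a ts)
  then show ?case by (auto simp: verts_Node)
qed

lemma leaf_labels_eq: "leaf_labels t = deco t ` leaves t"
proof (induction t)
  case (Node a ts)
  show ?case
  proof (cases "ts = []")
    case True
    then show ?thesis by (auto simp: leaves_def verts_Node)
  next
    case False
    have "leaves (Node a ts) = (\<Union>i<length ts. (#) i ` leaves (ts ! i))"
    proof (rule set_eqI)
      fix p
      show "p \<in> leaves (Node a ts) \<longleftrightarrow> p \<in> (\<Union>i<length ts. (#) i ` leaves (ts ! i))"
      proof (cases p)
        case Nil
        have "[0] \<in> verts (Node a ts)"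
          using False by (simp add: verts_def)
        moreover have "strict_prefix [] [0]" by simp
        ultimately have "p \<notin> leaves (Node a ts)" unfolding leaves_def Nil by blast
        then show ?thesis using Nil by auto
      next
        case (Cons i q)
        have 1: "p \<in> verts (Node a ts) \<longleftrightarrow> i < length ts \<and> q \<in> verts (ts ! i)"
          using Cons by (auto simp: verts_Node)
        have 2: "(\<exists>w\<in>verts (Node a ts). strict_prefix p w) \<longleftrightarrow> (\<exists>w\<in>verts (ts ! i). strict_prefix q w)"
          if "i < length ts" using Cons that by (auto simp: verts_Node)
        show ?thesis
          using 1 2 Cons by (auto simp: leaves_def image_iff)
      qed
    qed
    then have "deco (Node a ts) ` leaves (Node a ts) = (\<Union>i<length ts. deco (ts ! i) ` leaves (ts ! i))"
      by (simp add: image_UN image_image)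
    also have "\<dots> = (\<Union>i<length ts. leaf_labels (ts ! i))"
      using Node.IH by simp
    also have "\<dots> = leaf_labels (Node a ts)"
      using False by (auto simp: set_conv_nth)
    finally show ?thesis by simp
  qed
qed

lemma conv_trees_letter_eq: "conv_trees_letter = {t. root t = Lx \<and> leaf_labels t \<subseteq> {Ly}}"
  by (auto simp: conv_trees_letter_def leaf_labels_eq)

lemma star_list_conv_trees_letter:
  assumes "s \<in> conv_trees_letter" "t \<in> conv_trees_letter"
  shows "set (star_list None s t) \<subseteq> conv_trees_letter"
  using assms leaf_labels_star_list[of _ s t] root_star_list[of _ None s t]
  by (fastforce simp: conv_trees_letter_eq)

lemma star_list_conv_trees_nat:
  assumes "s \<in> conv_trees_nat" "t \<in> conv_trees_nat"
  shows "set (star_list (Some (+)) s t) \<subseteq> conv_trees_nat"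
proof
  fix u assume u: "u \<in> set (star_list (Some (+)) s t)"
  have "root s \<in> labels s" "root t \<in> labels t"
    by (cases s; simp) (cases t; simp)
  with assms have "root s \<ge> 1" "root t \<ge> 1" "root s \<noteq> 1" "root t \<noteq> 1"
    by (auto simp: conv_trees_nat_def)
  \<comment> \<open>If the root comes from the product \<open>\<bullet>\<close>, it is a sum of two
    numbers that are at least 2.\<close>
  then have "root u \<noteq> 1"
    using root_star_list[OF u] by auto
  moreover have "labels u \<subseteq> {1..}"
    using labels_star_list[OF u, of "{1..}"] assms by (simp add: conv_trees_nat_def)
  ultimately show "u \<in> conv_trees_nat" by (simp add: conv_trees_nat_def)
qed

section \<open>Iterated integrals over trees\<close>

text \<open>Sigma-finiteness serves Fubini, and the topology makes the order relation jointly
  measurable. With weights in \<open>ennreal\<close> no integrability has to be known while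
  integrals are exchanged.\<close>

locale tree_integral = sigma_finite_measure M
  for M :: "'x::{second_countable_topology, linorder_topology} measure" +
  fixes w :: "'a \<Rightarrow> 'x \<Rightarrow> ennreal"
  assumes sets_M [measurable_cong]: "sets M = sets borel"
    and w_measurable [measurable]: "w a \<in> borel_measurable M"
begin

lemma space_M [simp]: "space M = UNIV"
  using sets_eq_imp_space_eq[OF sets_M] by simp

lemma measurable_M_borel: "f \<in> N \<rightarrow>\<^sub>M M \<Longrightarrow> f \<in> borel_measurable N"
  using measurable_cong_sets[OF refl sets_M] by blast

lemma pred_less_M [measurable (raw)]:
  "f \<in> N \<rightarrow>\<^sub>M M \<Longrightarrow> g \<in> N \<rightarrow>\<^sub>M M \<Longrightarrow> Measurable.pred N (\<lambda>x. f x < g x)"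
  by (intro borel_measurable_pred_less measurable_M_borel)

lemma pred_eq_M [measurable (raw)]:
  assumes [measurable]: "f \<in> N \<rightarrow>\<^sub>M M" "g \<in> N \<rightarrow>\<^sub>M M"
  shows "Measurable.pred N (\<lambda>x. f x = g x)"
proof -
  have "(\<lambda>x. f x = g x) = (\<lambda>x. \<not> f x < g x \<and> \<not> g x < f x)" by auto
  then show ?thesis by simp
qed

text \<open>The domain of the root variable is an argument because the children are integrated over
  \<open>{..<s}\<close>, with \<open>s\<close> bound. The detour through \<open>map iint ts\<close>
  gives the recursive calls the shape that primitive recursion through lists requires.\<close>

primrec iint :: "'a ptree \<Rightarrow> 'x set \<Rightarrow> ennreal" where
  "iint (Node a ts) = (\<lambda>X. \<integral>\<^sup>+s. indicator X s *
     (w a s * prod_list (map (\<lambda>J. J {..<s}) (map iint ts))) \<partial>M)"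

definition iint_density :: "'a ptree \<Rightarrow> 'x \<Rightarrow> ennreal" where
  "iint_density t s = w (root t) s * (\<Prod>c\<leftarrow>children t. iint c {..<s})"

lemma iint_density_Node [simp]:
  "iint_density (Node a ts) s = w a s * (\<Prod>c\<leftarrow>ts. iint c {..<s})"
  by (simp add: iint_density_def)

lemma iint_eq: "iint t X = (\<integral>\<^sup>+s. indicator X s * iint_density t s \<partial>M)"
  by (cases t) (simp add: o_def)

declare iint.simps [simp del]

lemma borel_measurable_prod_list [measurable (raw)]:
  fixes f :: "'b \<Rightarrow> 'c \<Rightarrow> ennreal"
  assumes "\<And>c. c \<in> set cs \<Longrightarrow> f c \<in> borel_measurable N"
  shows "(\<lambda>s. \<Prod>c\<leftarrow>cs. f c s) \<in> borel_measurable N"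
  using assms by (induction cs) auto

lemma iint_density_measurable [measurable]: "iint_density t \<in> borel_measurable M"
proof (induction t)
  case (Node a ts)
  have [measurable]: "(\<lambda>s. iint c {..<s}) \<in> borel_measurable M" if "c \<in> set ts" for c
  proof -
    note Node.IH[OF that, measurable]
    show ?thesis
      \<comment> \<open>Once membership in \<open>{..<s}\<close> is a strict inequality, the
        integrand is jointly measurable in both variables, so its integral is measurable in
        \<open>s\<close>.\<close>
      unfolding iint_eq indicator_def lessThan_iff by measurable
  qed
  show ?case
    by (simp add: iint_density_Node[abs_def])
qed

lemma iint_lessThan_measurable [measurable]: "(\<lambda>s. iint t {..<s}) \<in> borel_measurable M"
  unfolding iint_eq indicator_def lessThan_iff by measurable

text \<open>The square \<open>X \<times> X\<close> is cut along its diagonal.\<close>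

lemma iint_mult:
  assumes [measurable]: "X \<in> sets M" and X: "\<And>s r. s \<in> X \<Longrightarrow> r < s \<Longrightarrow> r \<in> X"
  shows "iint S X * iint T X =
    (\<integral>\<^sup>+s. indicator X s * (iint_density S s * iint T {..<s}) \<partial>M) +
    (\<integral>\<^sup>+s. indicator X s * (iint_density T s * iint S {..<s}) \<partial>M) +
    (\<integral>\<^sup>+s. indicator X s * (iint_density S s * iint_density T s) * emeasure M {s} \<partial>M)"
proof -
  interpret pair: pair_sigma_finite M M ..
  let ?f = "iint_density S" and ?g = "iint_density T"
  let ?lt = "\<lambda>s r. indicator X s * ?f s * (indicator {..<s} r * ?g r)"
  let ?gt = "\<lambda>s r. indicator X r * ?g r * (indicator {..<r} s * ?f s)"
  let ?eq = "\<lambda>s r. indicator X s * (?f s * ?g s) * indicator {s} r"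
  have meas: "case_prod ?lt \<in> borel_measurable (M \<Otimes>\<^sub>M M)" "case_prod ?gt \<in> borel_measurable (M \<Otimes>\<^sub>M M)"
    "case_prod ?eq \<in> borel_measurable (M \<Otimes>\<^sub>M M)"
    unfolding indicator_def singleton_iff lessThan_iff by measurable
  have meas': "?lt s \<in> borel_measurable M" "?gt s \<in> borel_measurable M" "?eq s \<in> borel_measurable M" for s
    using meas[THEN measurable_Pair2, of s] by auto
  note meas_int = borel_measurable_nn_integral[OF meas(1)]
    borel_measurable_nn_integral[OF meas(2)] borel_measurable_nn_integral[OF meas(3)]
  have "iint S X * iint T X = (\<integral>\<^sup>+s. (\<integral>\<^sup>+r. (indicator X s * ?f s) * (indicator X r * ?g r) \<partial>M) \<partial>M)"
    unfolding iint_eq by (simp add: nn_integral_cmult nn_integral_multc)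
  also have "\<dots> = (\<integral>\<^sup>+s. (\<integral>\<^sup>+r. ?lt s r + ?gt s r + ?eq s r \<partial>M) \<partial>M)"
  proof (intro nn_integral_cong)
    fix s r
    show "(indicator X s * ?f s) * (indicator X r * ?g r) = ?lt s r + ?gt s r + ?eq s r"
      by (cases s r rule: linorder_cases)
        (use X in \<open>auto simp: indicator_def algebra_simps\<close>)
  qed
  also have "\<dots> = (\<integral>\<^sup>+s. (\<integral>\<^sup>+r. ?lt s r \<partial>M) + (\<integral>\<^sup>+r. ?gt s r \<partial>M) + (\<integral>\<^sup>+r. ?eq s r \<partial>M) \<partial>M)"
    using meas' by (simp add: nn_integral_add)
  also have "\<dots> = (\<integral>\<^sup>+s. (\<integral>\<^sup>+r. ?lt s r \<partial>M) \<partial>M) + (\<integral>\<^sup>+s. (\<integral>\<^sup>+r. ?gt s r \<partial>M) \<partial>M) +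
      (\<integral>\<^sup>+s. (\<integral>\<^sup>+r. ?eq s r \<partial>M) \<partial>M)"
    by (simp only: nn_integral_add borel_measurable_add meas_int)
  \<comment> \<open>In this region \<open>r\<close> is the larger variable, so the integrals are
    exchanged to make it the outer one.\<close>
  also have "(\<integral>\<^sup>+s. (\<integral>\<^sup>+r. ?gt s r \<partial>M) \<partial>M) = (\<integral>\<^sup>+r. (\<integral>\<^sup>+s. ?gt s r \<partial>M) \<partial>M)"
    by (rule pair.Fubini'[symmetric, OF meas(2)])
  finally show ?thesis
    by (simp add: iint_eq nn_integral_cmult nn_integral_cmult_indicator sets_M mult.assoc)
qed

text \<open>Linearity in a single child: a sum over trees grafted at one position moves inside the
  root integral, where an induction hypothesis can replace it by a product.\<close>

lemma iint_sum_list_Node: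
  assumes [measurable]: "X \<in> sets M"
  shows "(\<Sum>c\<leftarrow>cs. iint (Node a (us @ c # vs)) X) =
    (\<integral>\<^sup>+s. indicator X s * (w a s * (\<Prod>c\<leftarrow>us. iint c {..<s}) * (\<Sum>c\<leftarrow>cs. iint c {..<s}) *
       (\<Prod>c\<leftarrow>vs. iint c {..<s})) \<partial>M)"
proof (induction cs)
  case (Cons c cs)
  have [measurable]: "(\<lambda>s. \<Sum>c\<leftarrow>cs. iint c {..<s}) \<in> borel_measurable M"
    by (induction cs) auto
  show ?case
    by (simp add: Cons.IH, subst iint_eq, subst nn_integral_add[symmetric])
      (auto intro!: nn_integral_cong simp: algebra_simps)
qed simp

text \<open>The three terms of \<open>iint_mult\<close> match the three blocks of
  \<open>star_list\<close>. In the first, \<open>iint T {..<s}\<close> meets the integral of the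
  last child of \<open>S\<close> over the same initial segment, and the induction hypothesis for
  \<open>{..<s}\<close> expands their product; if \<open>S\<close> is a leaf, \<open>T\<close>
  becomes its only child. The other blocks are treated alike, the third with both root weights at
  one point.\<close>

theorem iint_star_list:
  assumes "X \<in> sets M" "\<And>s r. s \<in> X \<Longrightarrow> r < s \<Longrightarrow> r \<in> X"
    and "\<And>x. emeasure M {x} = (if m = None then 0 else 1)"
    and "\<And>f a b x. m = Some f \<Longrightarrow> w (f a b) x = w a x * w b x"
  shows "(\<Sum>u\<leftarrow>star_list m S T. iint u X) = iint S X * iint T X"
  using assms
proof (induction m S T arbitrary: X rule: star_list.induct)
  case (1 m a ss b ts)
  have m: "ss \<noteq> [] \<Longrightarrow> (\<Sum>u\<leftarrow>star_list m (last ss) (Node b ts). iint u {..<s}) =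
      iint (last ss) {..<s} * iint (Node b ts) {..<s}"
    "ts \<noteq> [] \<Longrightarrow> (\<Sum>u\<leftarrow>star_list m (Node a ss) (hd ts). iint u {..<s}) =
      iint (Node a ss) {..<s} * iint (hd ts) {..<s}"
    "m = Some f \<Longrightarrow> ss \<noteq> [] \<Longrightarrow> ts \<noteq> [] \<Longrightarrow> (\<Sum>u\<leftarrow>star_list m (last ss) (hd ts). iint u {..<s}) =
      iint (last ss) {..<s} * iint (hd ts) {..<s}" for s f
    by (rule "1.IH"; use "1.prems"(3,4) in \<open>simp add: sets_M\<close>)+
  have split_last: "(\<Prod>c\<leftarrow>ss. h c) = (\<Prod>c\<leftarrow>butlast ss. h c) * h (last ss)" if "ss \<noteq> []"
    for h :: "'a ptree \<Rightarrow> ennreal"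
    using that by (cases ss rule: rev_cases) auto
  have split_hd: "(\<Prod>c\<leftarrow>ts. h c) = h (hd ts) * (\<Prod>c\<leftarrow>tl ts. h c)" if "ts \<noteq> []"
    for h :: "'a ptree \<Rightarrow> ennreal"
    using that by (cases ts) auto
  note X = "1.prems"(1) and w = "1.prems"(4)
  have lt: "(\<Sum>u\<leftarrow>map (Node a) (if ss = [] then [[Node b ts]]
       else map (\<lambda>w. butlast ss @ [w]) (star_list m (last ss) (Node b ts))). iint u X) =
      (\<integral>\<^sup>+s. indicator X s * (iint_density (Node a ss) s * iint (Node b ts) {..<s}) \<partial>M)"
  proof (cases "ss = []")
    case True
    then show ?thesis by (simp add: iint_eq[of "Node a [Node b ts]"])
  next
    case False
    show ?thesis
      using iint_sum_list_Node[OF X, of a "butlast ss" "[]" "star_list m (last ss) (Node b ts)"]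
      by (simp add: False o_def m(1) split_last mult.assoc)
  qed
  have gt: "(\<Sum>u\<leftarrow>map (Node b) (if ts = [] then [[Node a ss]]
       else map (\<lambda>w. w # tl ts) (star_list m (Node a ss) (hd ts))). iint u X) =
      (\<integral>\<^sup>+s. indicator X s * (iint_density (Node b ts) s * iint (Node a ss) {..<s}) \<partial>M)"
  proof (cases "ts = []")
    case True
    then show ?thesis by (simp add: iint_eq[of "Node b [Node a ss]"])
  next
    case False
    show ?thesis
      using iint_sum_list_Node[OF X, of b "[]" "tl ts" "star_list m (Node a ss) (hd ts)"]
      by (simp add: False o_def m(2) split_hd mult_ac)
  qed
  have bullet: "(\<Sum>u\<leftarrow>map (Node (f a b)) (if ss = [] then [ts] else if ts = [] then [ss]
         else map (\<lambda>w. butlast ss @ w # tl ts) (star_list m (last ss) (hd ts))). iint u X) =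
      (\<integral>\<^sup>+s. indicator X s * (iint_density (Node a ss) s * iint_density (Node b ts) s) \<partial>M)"
    if f: "m = Some f" for f
  proof -
    consider "ss = []" | "ss \<noteq> []" "ts = []" | (both) "ss \<noteq> []" "ts \<noteq> []" by blast
    then show ?thesis
    proof cases
      case both
      show ?thesis
        using iint_sum_list_Node[OF X, of "f a b" "butlast ss" "tl ts" "star_list m (last ss) (hd ts)"]
        by (simp add: both o_def m(3)[OF f both] split_hd split_last w[OF f] mult_ac)
    qed (simp_all add: iint_eq[of "Node (f a b) _"] w[OF f] mult_ac)
  qed
  have "iint (Node a ss) X * iint (Node b ts) X =
    (\<integral>\<^sup>+s. indicator X s * (iint_density (Node a ss) s * iint (Node b ts) {..<s}) \<partial>M) +
    (\<integral>\<^sup>+s. indicator X s * (iint_density (Node b ts) s * iint (Node a ss) {..<s}) \<partial>M) +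
    (\<integral>\<^sup>+s. indicator X s * (iint_density (Node a ss) s * iint_density (Node b ts) s) *
      (if m = None then 0 else 1) \<partial>M)"
    by (subst iint_mult) (use "1.prems" in auto)
  then show ?case
    unfolding star_list.simps map_append sum_list_append lt gt
    using bullet by (cases m) (auto simp: add.assoc)
qed



section \<open>Product measures on families indexed by vertices\<close>

sublocale PiM: product_sigma_finite "\<lambda>_::'i. M"
  by standard

text \<open>A product measure is determined by its values on boxes, and pulling families back along
  the injection \<open>h\<close> preserves these values.\<close>

lemma nn_integral_PiM_reindex:
  fixes h :: "'i \<Rightarrow> 'j"
  assumes V: "finite V" and h: "inj_on h V"
    and g: "g \<in> borel_measurable (Pi\<^sub>M V (\<lambda>_. M))"
  shows "(\<integral>\<^sup>+z. g (\<lambda>p\<in>V. z (h p)) \<partial>Pi\<^sub>M (h ` V) (\<lambda>_. M)) = integral\<^sup>N (Pi\<^sub>M V (\<lambda>_. M)) g"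
proof -
  let ?r = "\<lambda>z. \<lambda>p\<in>V. z (h p)"
  have r: "?r \<in> Pi\<^sub>M (h ` V) (\<lambda>_. M) \<rightarrow>\<^sub>M Pi\<^sub>M V (\<lambda>_. M)"
    by (intro measurable_restrict measurable_component_singleton) auto
  have "distr (Pi\<^sub>M (h ` V) (\<lambda>_. M)) (Pi\<^sub>M V (\<lambda>_. M)) ?r = Pi\<^sub>M V (\<lambda>_. M)"
  proof (rule PiM.PiM_eqI[OF V])
    fix A :: "'i \<Rightarrow> 'x set" assume A: "\<And>i. i \<in> V \<Longrightarrow> A i \<in> sets M"
    let ?B = "\<lambda>q. A (the_inv_into V h q)"
    have B: "?B (h i) = A i" if "i \<in> V" for i
      using that h by (simp add: the_inv_into_f_f)
    have "?r -` Pi\<^sub>E V A \<inter> space (Pi\<^sub>M (h ` V) (\<lambda>_. M)) = Pi\<^sub>E (h ` V) ?B"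
      using B by (auto simp: space_PiM PiE_iff)
    then have "emeasure (distr (Pi\<^sub>M (h ` V) (\<lambda>_. M)) (Pi\<^sub>M V (\<lambda>_. M)) ?r) (Pi\<^sub>E V A) =
        emeasure (Pi\<^sub>M (h ` V) (\<lambda>_. M)) (Pi\<^sub>E (h ` V) ?B)"
      using r A V by (simp add: emeasure_distr sets_PiM_I_finite)
    also have "\<dots> = (\<Prod>q\<in>h ` V. emeasure M (?B q))"
      using A B V by (intro PiM.emeasure_PiM) auto
    also have "\<dots> = (\<Prod>i\<in>V. emeasure M (A i))"
      using B h by (simp add: prod.reindex)
    finally show "emeasure (distr (Pi\<^sub>M (h ` V) (\<lambda>_. M)) (Pi\<^sub>M V (\<lambda>_. M)) ?r) (Pi\<^sub>E V A) =
      (\<Prod>i\<in>V. emeasure M (A i))" .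
  qed simp
  then show ?thesis
    using nn_integral_distr[OF r, of g] g by simp
qed

text \<open>Addresses with different first entries are disjoint, so the variables of different
  subtrees separate. The induction splits off the last subtree by Fubini and removes its leading
  index by \<open>nn_integral_PiM_reindex\<close>.\<close>

lemma nn_integral_PiM_UN:
  fixes V :: "nat \<Rightarrow> nat list set"
  assumes "\<And>i. i < n \<Longrightarrow> finite (V i)"
    and "\<And>i. i < n \<Longrightarrow> g i \<in> borel_measurable (Pi\<^sub>M (V i) (\<lambda>_. M))"
  shows "(\<integral>\<^sup>+z. (\<Prod>i<n. g i (\<lambda>p\<in>V i. z (i # p))) \<partial>Pi\<^sub>M (\<Union>i<n. (#) i ` V i) (\<lambda>_. M)) =
    (\<Prod>i<n. integral\<^sup>N (Pi\<^sub>M (V i) (\<lambda>_. M)) (g i))"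
  using assms
proof (induction n)
  case 0
  then show ?case by (simp add: space_PiM PiM_empty nn_integral_count_space_finite)
next
  case (Suc n)
  let ?I = "\<Union>i<n. (#) i ` V i" and ?J = "(#) n ` V n"
  let ?G = "\<lambda>i z. g i (\<lambda>p\<in>V i. z (i # p))"
  have UN: "(\<Union>i<Suc n. (#) i ` V i) = ?I \<union> ?J"
    by (simp add: lessThan_Suc Un_commute)
  have disj: "?I \<inter> ?J = {}" and fin: "finite ?I" "finite ?J"
    using Suc.prems(1) by auto
  have sub: "(#) i ` V i \<subseteq> ?I \<union> ?J" if "i \<in> {..<Suc n}" for i
    unfolding UN[symmetric] using that by (rule UN_upper)
  have G: "?G i \<in> borel_measurable (Pi\<^sub>M K (\<lambda>_. M))" if "i < Suc n" "(#) i ` V i \<subseteq> K" for i K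
    using that
    by (intro measurable_compose[OF _ Suc.prems(2)] measurable_restrict measurable_component_singleton) auto
  have restrict_I: "?G i (merge ?I ?J (x, y)) = ?G i x" if "i < n" for i x y
    using that by (intro arg_cong[where f = "g i"] ext) (auto simp: merge_def restrict_def)
  have restrict_J: "?G n (merge ?I ?J (x, y)) = ?G n y" for x y
    by (intro arg_cong[where f = "g n"] ext) (auto simp: merge_def restrict_def)
  have "(\<integral>\<^sup>+z. (\<Prod>i<Suc n. ?G i z) \<partial>Pi\<^sub>M (\<Union>i<Suc n. (#) i ` V i) (\<lambda>_. M)) =
    (\<integral>\<^sup>+x. (\<integral>\<^sup>+y. (\<Prod>i<Suc n. ?G i (merge ?I ?J (x, y))) \<partial>Pi\<^sub>M ?J (\<lambda>_. M)) \<partial>Pi\<^sub>M ?I (\<lambda>_. M))"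
    unfolding UN
    by (intro PiM.product_nn_integral_fold disj fin borel_measurable_prod_ennreal G sub) auto
  also have "\<dots> = (\<integral>\<^sup>+x. (\<Prod>i<n. ?G i x) * (\<integral>\<^sup>+y. ?G n y \<partial>Pi\<^sub>M ?J (\<lambda>_. M)) \<partial>Pi\<^sub>M ?I (\<lambda>_. M))"
  proof (intro nn_integral_cong)
    fix x
    have "(\<Prod>i<Suc n. ?G i (merge ?I ?J (x, y))) = (\<Prod>i<n. ?G i x) * ?G n y" for y
      unfolding prod.lessThan_Suc restrict_J
      by (intro arg_cong2[where f = "(*)"] prod.cong refl restrict_I) simp
    then show "(\<integral>\<^sup>+y. (\<Prod>i<Suc n. ?G i (merge ?I ?J (x, y))) \<partial>Pi\<^sub>M ?J (\<lambda>_. M)) =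
        (\<Prod>i<n. ?G i x) * (\<integral>\<^sup>+y. ?G n y \<partial>Pi\<^sub>M ?J (\<lambda>_. M))"
      using nn_integral_cmult[OF G[of n ?J]] by simp
  qed
  also have "\<dots> = (\<integral>\<^sup>+x. (\<Prod>i<n. ?G i x) \<partial>Pi\<^sub>M ?I (\<lambda>_. M)) * (\<integral>\<^sup>+y. ?G n y \<partial>Pi\<^sub>M ?J (\<lambda>_. M))"
    by (rule nn_integral_multc) (intro borel_measurable_prod_ennreal G; auto)
  also have "(\<integral>\<^sup>+x. (\<Prod>i<n. ?G i x) \<partial>Pi\<^sub>M ?I (\<lambda>_. M)) = (\<Prod>i<n. integral\<^sup>N (Pi\<^sub>M (V i) (\<lambda>_. M)) (g i))"
    using Suc.prems by (intro Suc.IH) auto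
  also have "(\<integral>\<^sup>+y. ?G n y \<partial>Pi\<^sub>M ?J (\<lambda>_. M)) = integral\<^sup>N (Pi\<^sub>M (V n) (\<lambda>_. M)) (g n)"
    using Suc.prems by (intro nn_integral_PiM_reindex) auto
  finally show ?case by simp
qed

section \<open>Iterated integrals as integrals over all vertices\<close>

definition decreasing :: "'a ptree \<Rightarrow> (nat list \<Rightarrow> 'x) \<Rightarrow> bool" where
  "decreasing t z \<longleftrightarrow> (\<forall>u\<in>verts t. \<forall>v\<in>verts t. strict_prefix u v \<longrightarrow> z v < z u)"

text \<open>The order condition is a factor of the integrand rather than a domain, so that it splits
  along the subtrees. The range of the variables is left to the weights \<open>w\<close>.\<close>

definition weight :: "'a ptree \<Rightarrow> (nat list \<Rightarrow> 'x) \<Rightarrow> ennreal" where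
  "weight t z = of_bool (decreasing t z) * (\<Prod>v\<in>verts t. w (deco t v) (z v))"

text \<open>Comparing the root with its children suffices, since within a subtree every other vertex
  has a smaller value than the root of that subtree.\<close>

lemma decreasing_Node:
  "decreasing (Node a ts) z \<longleftrightarrow>
    (\<forall>i<length ts. z [i] < z [] \<and> decreasing (ts ! i) (\<lambda>p. z (i # p)))"
proof
  assume L: "decreasing (Node a ts) z"
  show "\<forall>i<length ts. z [i] < z [] \<and> decreasing (ts ! i) (\<lambda>p. z (i # p))"
  proof (intro allI impI conjI)
    fix i assume i: "i < length ts"
    have "[i] \<in> verts (Node a ts)" "strict_prefix [] [i]"
      using i by (auto simp: verts_def)
    then show "z [i] < z []" using L unfolding decreasing_def by (meson Nil_in_verts)
    have "i # u \<in> verts (Node a ts)" if "u \<in> verts (ts ! i)" for u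
      using i that by (auto simp: verts_def)
    moreover have "strict_prefix (i # u) (i # v)" if "strict_prefix u v" for u v
      using that by simp
    ultimately show "decreasing (ts ! i) (\<lambda>p. z (i # p))"
      using L unfolding decreasing_def by meson
  qed
next
  assume R: "\<forall>i<length ts. z [i] < z [] \<and> decreasing (ts ! i) (\<lambda>p. z (i # p))"
  have below: "z (i # q) < z []" if "i < length ts" "q \<in> verts (ts ! i)" for i q
  proof (cases "q = []")
    case False
    then have "strict_prefix [] q" by (cases q) auto
    then have "z (i # q) < z [i]" using R that unfolding decreasing_def by (meson Nil_in_verts)
    then show ?thesis using R that by (meson less_trans)
  qed (use R that in auto)
  show "decreasing (Node a ts) z"
    unfolding decreasing_def verts_Node
    using R below by (auto simp: decreasing_def)
qed

lemma weight_Node: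
  "weight (Node a ts) z =
    w a (z []) * (\<Prod>i<length ts. indicator {..<z []} (z [i]) * weight (ts ! i) (\<lambda>p. z (i # p)))"
proof -
  have "(\<Prod>v\<in>verts (Node a ts). w (deco (Node a ts) v) (z v)) =
      w a (z []) * (\<Prod>v\<in>(\<Union>i<length ts. (#) i ` verts (ts ! i)). w (deco (Node a ts) v) (z v))"
    unfolding verts_Node by (subst prod.insert) auto
  also have "(\<Prod>v\<in>(\<Union>i<length ts. (#) i ` verts (ts ! i)). w (deco (Node a ts) v) (z v)) =
      (\<Prod>i<length ts. \<Prod>v\<in>(#) i ` verts (ts ! i). w (deco (Node a ts) v) (z v))"
    by (intro prod.UNION_disjoint) auto
  also have "\<dots> = (\<Prod>i<length ts. \<Prod>v\<in>verts (ts ! i). w (deco (ts ! i) v) (z (i # v)))"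
    by (simp add: prod.reindex)
  finally have *: "(\<Prod>v\<in>verts (Node a ts). w (deco (Node a ts) v) (z v)) =
    w a (z []) * (\<Prod>i<length ts. \<Prod>v\<in>verts (ts ! i). w (deco (ts ! i) v) (z (i # v)))" .
  have of_bool_All: "of_bool (\<forall>i<n. P i) = (\<Prod>i<n. of_bool (P i) :: ennreal)" for P and n :: nat
    by (induction n) (auto simp: less_Suc_eq all_conj_distrib)
  show ?thesis
    by (simp add: weight_def * decreasing_Node of_bool_All of_bool_conj indicator_def prod.distrib
        algebra_simps)
qed

lemma weight_cong:
  assumes "\<And>p. p \<in> verts t \<Longrightarrow> z p = z' p"
  shows "weight t z = weight t z'"
  using assms by (simp add: weight_def decreasing_def cong: prod.cong)

lemma weight_measurable [measurable]:
  "weight t \<in> borel_measurable (Pi\<^sub>M (verts t) (\<lambda>_. M))"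
proof -
  have [measurable]: "(\<lambda>z. z v) \<in> Pi\<^sub>M (verts t) (\<lambda>_. M) \<rightarrow>\<^sub>M M" if "v \<in> verts t" for v
    using that by (rule measurable_component_singleton)
  have "Measurable.pred (Pi\<^sub>M (verts t) (\<lambda>_. M)) (decreasing t)"
    unfolding decreasing_def
    by (intro pred_intros_finite pred_intros_logic finite_verts) measurable
  moreover have "(\<lambda>z. \<Prod>v\<in>verts t. w (deco t v) (z v)) \<in> borel_measurable (Pi\<^sub>M (verts t) (\<lambda>_. M))"
    by (intro borel_measurable_prod_ennreal) measurable
  ultimately show ?thesis
    unfolding weight_def[abs_def] by measurable
qed

text \<open>With the root variable \<open>s\<close> outermost, the remaining integral factors over
  the subtrees. The condition that a child lies below \<open>s\<close> is the set
  \<open>{..<s}\<close> in the induction hypothesis, which is why \<open>X\<close> is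
  arbitrary.\<close>

theorem nn_integral_weight:
  assumes "X \<in> sets M"
  shows "(\<integral>\<^sup>+z. indicator X (z []) * weight t z \<partial>Pi\<^sub>M (verts t) (\<lambda>_. M)) = iint t X"
  using assms
proof (induction t arbitrary: X)
  case (Node a ts)
  note Node.prems [measurable]
  let ?I = "\<Union>i<length ts. (#) i ` verts (ts ! i)"
  let ?g = "\<lambda>s i z. indicator {..<s} (z []) * weight (ts ! i) z"
  have root_measurable: "(\<lambda>z. z []) \<in> Pi\<^sub>M (verts t) (\<lambda>_. M) \<rightarrow>\<^sub>M M" for t :: "'a ptree"
    by (rule measurable_component_singleton) simp
  have g: "?g s i \<in> borel_measurable (Pi\<^sub>M (verts (ts ! i)) (\<lambda>_. M))" for s i
  proof -
    have [measurable]: "{..<s} \<in> sets M"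
      by (simp add: sets_M)
    show ?thesis
      using root_measurable[of "ts ! i", measurable] by measurable
  qed
  have weight_upd: "weight (Node a ts) (x([] := s)) =
      w a s * (\<Prod>i<length ts. ?g s i (\<lambda>p\<in>verts (ts ! i). x (i # p)))" for x s
    unfolding weight_Node
    by (auto intro!: arg_cong2[where f = "(*)"] prod.cong weight_cong)
  have "(\<integral>\<^sup>+z. indicator X (z []) * weight (Node a ts) z \<partial>Pi\<^sub>M (verts (Node a ts)) (\<lambda>_. M)) =
    (\<integral>\<^sup>+s. (\<integral>\<^sup>+x. indicator X s * weight (Node a ts) (x([] := s)) \<partial>Pi\<^sub>M ?I (\<lambda>_. M)) \<partial>M)"
  proof -
    have "(\<lambda>z. indicator X (z []) * weight (Node a ts) z) \<in> borel_measurable (Pi\<^sub>M (verts (Node a ts)) (\<lambda>_. M))"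
      using root_measurable[of "Node a ts", measurable] by measurable
    then show ?thesis
      unfolding verts_Node by (subst PiM.product_nn_integral_insert_rev) auto
  qed
  also have "\<dots> = (\<integral>\<^sup>+s. indicator X s * (w a s * (\<Prod>i<length ts. iint (ts ! i) {..<s})) \<partial>M)"
  proof (intro nn_integral_cong)
    fix s
    have meas: "(\<lambda>x. \<Prod>i<length ts. ?g s i (\<lambda>p\<in>verts (ts ! i). x (i # p))) \<in> borel_measurable (Pi\<^sub>M ?I (\<lambda>_. M))"
      by (intro borel_measurable_prod_ennreal measurable_compose[OF _ g] measurable_restrict
          measurable_component_singleton) auto
    have "(\<integral>\<^sup>+x. indicator X s * weight (Node a ts) (x([] := s)) \<partial>Pi\<^sub>M ?I (\<lambda>_. M)) =
       indicator X s * (w a s * (\<integral>\<^sup>+x. (\<Prod>i<length ts. ?g s i (\<lambda>p\<in>verts (ts ! i). x (i # p))) \<partial>Pi\<^sub>M ?I (\<lambda>_. M)))"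
      unfolding weight_upd mult.assoc[symmetric] using meas by (rule nn_integral_cmult)
    also have "(\<integral>\<^sup>+x. (\<Prod>i<length ts. ?g s i (\<lambda>p\<in>verts (ts ! i). x (i # p))) \<partial>Pi\<^sub>M ?I (\<lambda>_. M)) =
        (\<Prod>i<length ts. integral\<^sup>N (Pi\<^sub>M (verts (ts ! i)) (\<lambda>_. M)) (?g s i))"
      using g by (intro nn_integral_PiM_UN) auto
    also have "\<dots> = (\<Prod>i<length ts. iint (ts ! i) {..<s})"
      by (intro prod.cong Node.IH) (auto simp: sets_M)
    finally show "(\<integral>\<^sup>+x. indicator X s * weight (Node a ts) (x([] := s)) \<partial>Pi\<^sub>M ?I (\<lambda>_. M)) =
      indicator X s * (w a s * (\<Prod>i<length ts. iint (ts ! i) {..<s}))" .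
  qed
  also have "\<dots> = iint (Node a ts) X"
    unfolding iint_eq iint_density_Node
    by (simp add: prod.list_conv_set_nth atLeast0LessThan)
  finally show ?case .
qed


lemma nn_integral_weight_UNIV:
  "(\<integral>\<^sup>+z. weight t z \<partial>Pi\<^sub>M (verts t) (\<lambda>_. M)) = iint t UNIV"
  using nn_integral_weight[of UNIV t] sets.top[of M] by simp

text \<open>The sum equals a finite product, so all its summands are finite and
  \<open>enn2real\<close> is additive on them.\<close>

lemma enn2real_iint_star_list:
  assumes "\<And>x. emeasure M {x} = (if m = None then 0 else 1)"
    and "\<And>f a b x. m = Some f \<Longrightarrow> w (f a b) x = w a x * w b x"
    and finite: "iint s UNIV < top" "iint t UNIV < top"
  shows "(\<Sum>u\<leftarrow>star_list m s t. enn2real (iint u UNIV)) = enn2real (iint s UNIV) * enn2real (iint t UNIV)"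
proof -
  have eq: "(\<Sum>u\<leftarrow>star_list m s t. iint u UNIV) = iint s UNIV * iint t UNIV"
    using assms(1,2) by (intro iint_star_list) (auto simp: sets_M)
  have "(\<Sum>u\<leftarrow>us. iint u UNIV) < top \<Longrightarrow>
      (\<Sum>u\<leftarrow>us. enn2real (iint u UNIV)) = enn2real (\<Sum>u\<leftarrow>us. iint u UNIV)" for us
    by (induction us) (auto simp: enn2real_plus)
  moreover have "iint s UNIV * iint t UNIV < top"
    using finite by (simp add: ennreal_mult_less_top)
  ultimately show ?thesis
    by (simp add: eq enn2real_mult)
qed

end

section \<open>Multiple zeta series\<close>

text \<open>This is \<open>ln y \<le> y - 1\<close> at \<open>y = x powr (1 / c)\<close>. The term
  -1 matters: it absorbs an additive 1 in the bound for \<open>harm\<close> and yields a factor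
  \<open>z\<close> in the one for \<open>log_form\<close>.\<close>

lemma ln_le_powr:
  fixes x :: real
  assumes "x > 0" "c > 0"
  shows "ln x \<le> c * (x powr (1 / c) - 1)"
proof -
  have "ln x = c * ln (x powr (1 / c))" using assms by (simp add: ln_powr)
  also have "\<dots> \<le> c * (x powr (1 / c) - 1)"
    using assms by (intro mult_left_mono ln_le_minus_one) auto
  finally show ?thesis .
qed

lemma harm_le_powr:
  assumes "c \<ge> 1" "n > 0"
  shows "harm n \<le> c * real n powr (1 / c)"
proof -
  obtain k where n: "n = Suc k" using assms(2) by (cases n) auto
  \<comment> \<open>The difference of the harmonic number and the logarithm decreases, and it is 1
    at the first index.\<close>
  have "harm (Suc k) - ln (Suc k) \<le> (harm (Suc 0) - ln (Suc 0) :: real)"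
    using decseq_harm_diff_ln by (rule decseqD) simp
  then have "harm n \<le> 1 + ln (real n)" by (simp add: n harm_Suc harm_expand(1))
  also have "\<dots> \<le> 1 + c * (real n powr (1 / c) - 1)"
    using assms by (intro add_left_mono ln_le_powr) auto
  also have "\<dots> \<le> c * real n powr (1 / c)" using assms by (simp add: algebra_simps)
  finally show ?thesis .
qed

lemma sum_inverse_le_harm: "(\<Sum>k<n. 1 / real k) \<le> harm n"
proof -
  \<comment> \<open>The term at \<open>k = 0\<close> is 0 by the convention on division by zero, so
    the sum over \<open>k < Suc j\<close> has exactly the terms of \<open>harm j\<close>.\<close>
  have "(\<Sum>k<Suc j. 1 / real k) = harm j" for j
    by (induction j) (auto simp: harm_Suc divide_simps harm_expand)
  then show ?thesis
    using harm_mono[of "n - 1" n] by (cases n) (auto simp: harm_nonneg)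
qed

text \<open>Exponents of the children add up. The lower bound \<open>d\<close> is 0 for series; for
  integrals it is 1, so that a vertex with children has a positive exponent.\<close>

lemma prod_list_le_power:
  fixes f :: "'b \<Rightarrow> 'c \<Rightarrow> ennreal"
  assumes "\<And>c. c \<in> set cs \<Longrightarrow> \<exists>m\<ge>d. \<forall>x\<in>S. f c x \<le> g x ^ m"
  shows "\<exists>m\<ge>d * length cs. \<forall>x\<in>S. (\<Prod>c\<leftarrow>cs. f c x) \<le> g x ^ m"
  using assms
proof (induction cs)
  case Nil
  then show ?case by (auto intro!: exI[of _ 0])
next
  case (Cons c cs)
  obtain m where "m \<ge> d" "\<forall>x\<in>S. f c x \<le> g x ^ m"
    using Cons.prems[of c] by auto
  moreover obtain m' where "m' \<ge> d * length cs" "\<forall>x\<in>S. (\<Prod>c\<leftarrow>cs. f c x) \<le> g x ^ m'"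
    using Cons.IH Cons.prems by (meson list.set_intros(2))
  ultimately show ?case
    by (intro exI[of _ "m + m'"]) (auto intro!: mult_mono simp: power_add)
qed

text \<open>The indicator removes the index 0, which the type \<open>nat\<close> contains; for
  \<open>n = 0\<close> the quotient alone would give it weight 1.\<close>

definition zeta_weight :: "nat \<Rightarrow> nat \<Rightarrow> ennreal" where
  "zeta_weight n k = indicator {1..} k * ennreal (1 / real k ^ n)"

interpretation series: tree_integral "count_space UNIV" zeta_weight
proof -
  interpret sigma_finite_measure "count_space (UNIV :: nat set)"
    by (rule sigma_finite_measure_count_space)
  show "tree_integral (count_space UNIV) zeta_weight"
    by unfold_locales (simp_all add: sets_borel_eq_count_space)
qed

lemma series_iint_eq:
  "series.iint t X = suminf (\<lambda>k. indicator X k * series.iint_density t k)"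
  by (simp add: series.iint_eq nn_integral_count_space_nat)

lemma zeta_weight_add: "zeta_weight (a + b) k = zeta_weight a k * zeta_weight b k"
proof -
  have "ennreal (1 / real k ^ (a + b)) = ennreal (1 / real k ^ a) * ennreal (1 / real k ^ b)"
    by (subst ennreal_mult[symmetric]) (auto simp: power_add)
  then show ?thesis by (simp add: zeta_weight_def indicator_def)
qed

lemma zeta_weight_le: "n \<ge> m \<Longrightarrow> zeta_weight n k \<le> ennreal (1 / real k ^ m)"
  by (cases "k \<ge> 1") (auto simp: zeta_weight_def indicator_def intro!: ennreal_leI divide_left_mono power_increasing)

text \<open>Every vertex costs one factor \<open>harm n\<close>: its exponent is at least 1, and the
  bounds for its children at \<open>k < n\<close> are at most those at \<open>n\<close>.\<close>

lemma series_iint_le_harm: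
  assumes "labels t \<subseteq> {1..}"
  shows "\<exists>m. \<forall>n. series.iint t {..<n} \<le> ennreal (harm n) ^ m"
  using assms
proof (induction t)
  case (Node a ts)
  have "\<exists>m\<ge>0. \<forall>n\<in>UNIV. series.iint c {..<n} \<le> ennreal (harm n) ^ m" if "c \<in> set ts" for c
    using Node that by auto
  then obtain m where m: "(\<Prod>c\<leftarrow>ts. series.iint c {..<n}) \<le> ennreal (harm n) ^ m" for n
    using prod_list_le_power[of ts 0 UNIV "\<lambda>c n. series.iint c {..<n}" "\<lambda>n. ennreal (harm n)"] by auto
  have "series.iint (Node a ts) {..<n} \<le> ennreal (harm n) ^ Suc m" for n
  proof -
    have "series.iint (Node a ts) {..<n} = (\<Sum>k<n. series.iint_density (Node a ts) k)"
      unfolding series_iint_eq by (subst suminf_finite[of "{..<n}"]) auto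
    also have "\<dots> \<le> (\<Sum>k<n. ennreal (1 / real k) * ennreal (harm n) ^ m)"
    proof (intro sum_mono)
      fix k assume "k \<in> {..<n}"
      then have "ennreal (harm k) ^ m \<le> ennreal (harm n) ^ m"
        by (intro power_mono ennreal_leI harm_mono) auto
      with m[of k] have "(\<Prod>c\<leftarrow>ts. series.iint c {..<k}) \<le> ennreal (harm n) ^ m"
        by (rule order_trans)
      moreover have "zeta_weight a k \<le> ennreal (1 / real k)"
        using zeta_weight_le[of 1 a k] Node.prems by simp
      ultimately show "series.iint_density (Node a ts) k \<le> ennreal (1 / real k) * ennreal (harm n) ^ m"
        unfolding series.iint_density_Node by (intro mult_mono) auto
    qed
    also have "\<dots> = ennreal (\<Sum>k<n. 1 / real k) * ennreal (harm n) ^ m"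
      by (simp add: sum_distrib_right[symmetric])
    also have "\<dots> \<le> ennreal (harm n) * ennreal (harm n) ^ m"
      by (intro mult_right_mono ennreal_leI sum_inverse_le_harm) simp
    finally show ?thesis by simp
  qed
  then show ?case by blast
qed

text \<open>Any power of the harmonic numbers is bounded by a multiple of the square root of
  \<open>k\<close>, which leaves the convergent series of \<open>k powr (-3/2)\<close>.\<close>

lemma summable_harm_power_over_square: "summable (\<lambda>k. harm k ^ m / real k ^ 2)"
proof -
  \<comment> \<open>Chosen such that \<open>m / c\<close> is at most 1/2; the summand 2 keeps
    \<open>c \<ge> 1\<close> when \<open>m = 0\<close>.\<close>
  define c where "c = 2 * real m + 2"
  have c: "c \<ge> 1" "real m / c \<le> 1 / 2" by (auto simp: c_def field_simps)
  have "summable (\<lambda>k. c ^ m * real k powr (-3/2))"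
    by (intro summable_mult) (simp add: summable_real_powr_iff)
  moreover have "norm (harm k ^ m / real k ^ 2) \<le> c ^ m * real k powr (-3/2)" for k
  proof (cases "k = 0")
    case False
    then have k: "real k \<ge> 1" by simp
    have "harm k ^ m \<le> (c * real k powr (1 / c)) ^ m"
      using False c by (intro power_mono harm_le_powr harm_nonneg) auto
    also have "\<dots> = c ^ m * real k powr (real m / c)"
      using k by (simp add: power_mult_distrib powr_power)
    also have "\<dots> \<le> c ^ m * real k powr (1 / 2)"
      using k c by (intro mult_left_mono powr_mono) auto
    finally have "harm k ^ m / real k ^ 2 \<le> c ^ m * real k powr (1 / 2) / real k ^ 2"
      by (rule divide_right_mono) simp
    also have "\<dots> = c ^ m * (real k powr (1 / 2) / real k powr 2)"
      using k by (simp add: powr_numeral)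
    also have "real k powr (1 / 2) / real k powr 2 = real k powr (-3/2)"
      unfolding powr_diff[symmetric] by simp
    finally show ?thesis by (simp add: harm_nonneg)
  qed simp
  ultimately show ?thesis
    by (rule summable_comparison_test'[where N = 0])
qed

text \<open>The root exponent is at least 2 and supplies \<open>1 / k ^ 2\<close>, against which the
  harmonic powers from the children are summable.\<close>

lemma series_iint_finite:
  assumes "t \<in> conv_trees_nat"
  shows "series.iint t UNIV < top"
proof (cases t)
  case (Node a ts)
  have a: "a \<ge> 2" and ts: "\<Union> (labels ` set ts) \<subseteq> {1..}"
    using assms by (auto simp: conv_trees_nat_def Node)
  have "\<exists>m\<ge>0. \<forall>n\<in>UNIV. series.iint c {..<n} \<le> ennreal (harm n) ^ m" if "c \<in> set ts" for c
    using series_iint_le_harm[of c] ts that by auto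
  then obtain m where m: "(\<Prod>c\<leftarrow>ts. series.iint c {..<n}) \<le> ennreal (harm n) ^ m" for n
    using prod_list_le_power[of ts 0 UNIV "\<lambda>c n. series.iint c {..<n}" "\<lambda>n. ennreal (harm n)"] by auto
  have "series.iint t UNIV \<le> suminf (\<lambda>k. ennreal (harm k ^ m / real k ^ 2))"
    unfolding series_iint_eq
  proof (intro suminf_le)
    fix k
    have "series.iint_density t k \<le> ennreal (1 / real k ^ 2) * ennreal (harm k) ^ m"
      unfolding Node series.iint_density_Node using m zeta_weight_le[OF a] by (intro mult_mono) auto
    also have "\<dots> = ennreal (harm k ^ m / real k ^ 2)"
      by (simp add: ennreal_power harm_nonneg ennreal_mult[symmetric])
    finally show "indicator UNIV k * series.iint_density t k \<le> ennreal (harm k ^ m / real k ^ 2)" by simp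
  qed auto
  also have "\<dots> < top"
    unfolding less_top[symmetric]
    by (rule ennreal_suminf_neq_top[OF summable_harm_power_over_square]) (simp add: harm_nonneg)
  finally show ?thesis .
qed

text \<open>A finite product of counting measures is the counting measure on families, so the vertex
  integral is a sum. Its finiteness gives absolute summability, through which the unordered sum is
  identified with it.\<close>

lemma zeta_tree_eq_iint:
  assumes "t \<in> conv_trees_nat"
  shows "zeta_tree t = enn2real (series.iint t UNIV)"
proof -
  let ?f = "\<lambda>k. \<Prod>v\<in>verts t. 1 / real (k v) ^ deco t v"
  have sub: "zeta_domain t \<subseteq> verts t \<rightarrow>\<^sub>E UNIV"
    by (auto simp: zeta_domain_def)
  have weight: "series.weight t k = ennreal (?f k) * indicator (zeta_domain t) k"
    if "k \<in> verts t \<rightarrow>\<^sub>E UNIV" for k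
  proof (cases "\<forall>v\<in>verts t. k v \<ge> 1")
    case True
    then have "(\<Prod>v\<in>verts t. zeta_weight (deco t v) (k v)) = ennreal (?f k)"
      by (simp add: zeta_weight_def prod_ennreal)
    moreover have "k \<in> zeta_domain t \<longleftrightarrow> series.decreasing t k"
      using True that by (auto simp: zeta_domain_def series.decreasing_def PiE_iff)
    ultimately show ?thesis by (simp add: series.weight_def indicator_def)
  next
    case False
    then have "(\<Prod>v\<in>verts t. zeta_weight (deco t v) (k v)) = 0"
      by (auto simp: zeta_weight_def indicator_def intro!: prod_zero)
    moreover have "k \<notin> zeta_domain t" using False by (auto simp: zeta_domain_def PiE_iff)
    ultimately show ?thesis by (simp add: series.weight_def)
  qed
  have weight_domain: "indicator (verts t \<rightarrow>\<^sub>E UNIV) k * series.weight t k = ennreal (?f k) * indicator (zeta_domain t) k" for k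
    using weight[of k] sub by (auto simp: indicator_def)
  have PiM: "Pi\<^sub>M (verts t) (\<lambda>_. count_space (UNIV :: nat set)) = count_space (verts t \<rightarrow>\<^sub>E UNIV)"
    by (rule count_space_PiM_finite) auto
  have eq: "series.iint t UNIV = (\<integral>\<^sup>+k. ennreal (?f k) \<partial>count_space (zeta_domain t))"
    unfolding series.nn_integral_weight_UNIV[symmetric] PiM
    by (simp only: nn_integral_count_space_indicator[of "verts t \<rightarrow>\<^sub>E UNIV"]
        nn_integral_count_space_indicator[of "zeta_domain t"] weight_domain
        mult.commute[of "series.weight t _"] NO_MATCH_def)
  have nonneg: "0 \<le> ?f k" for k by (simp add: prod_nonneg)
  have fin: "(\<integral>\<^sup>+k. ennreal (?f k) \<partial>count_space (zeta_domain t)) \<noteq> \<infinity>"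
    using series_iint_finite[OF assms] by (simp add: eq)
  have "Infinite_Set_Sum.abs_summable_on ?f (zeta_domain t)"
    unfolding Infinite_Set_Sum.abs_summable_on_def
  proof (rule integrableI_nonneg)
    show "AE k in count_space (zeta_domain t). 0 \<le> ?f k"
      using nonneg by (rule AE_I2)
    show "(\<integral>\<^sup>+k. ennreal (?f k) \<partial>count_space (zeta_domain t)) < \<infinity>"
      using fin by (simp only: infinity_ennreal_def less_top)
  qed simp
  then have "zeta_tree t = infsetsum ?f (zeta_domain t)"
    unfolding zeta_tree_def by (rule infsetsum_infsum[symmetric])
  also have "\<dots> = enn2real (series.iint t UNIV)"
    unfolding eq using fin nonneg by (rule infsetsum_conv_nn_integral)
  finally show ?thesis .
qed

lemma sum_zeta_tree_star_list:
  assumes "s \<in> conv_trees_nat" "t \<in> conv_trees_nat"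
  shows "(\<Sum>u\<leftarrow>star_list (Some (+)) s t. zeta_tree u) = zeta_tree s * zeta_tree t"
proof -
  have "(\<Sum>u\<leftarrow>star_list (Some (+)) s t. zeta_tree u) =
      (\<Sum>u\<leftarrow>star_list (Some (+)) s t. enn2real (series.iint u UNIV))"
    using star_list_conv_trees_nat[OF assms]
    by (intro arg_cong[where f = sum_list] map_cong refl zeta_tree_eq_iint) auto
  also have "\<dots> = enn2real (series.iint s UNIV) * enn2real (series.iint t UNIV)"
    by (intro series.enn2real_iint_star_list series_iint_finite assms)
      (auto simp: zeta_weight_add)
  finally show ?thesis by (simp add: zeta_tree_eq_iint assms)
qed

section \<open>Multiple zeta integrals\<close>

text \<open>Integration is over the whole line, so the restriction of each variable to the unit
  interval is put into its weight.\<close>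

definition form_weight :: "letter \<Rightarrow> real \<Rightarrow> ennreal" where
  "form_weight d \<tau> = indicator {0..1} \<tau> * ennreal (form_density d \<tau>)"

lemma form_density_measurable [measurable]: "form_density d \<in> borel_measurable borel"
proof -
  have "form_density Lx = (\<lambda>\<tau>. 1 / \<tau>)" "form_density Ly = (\<lambda>\<tau>. 1 / (1 - \<tau>))"
    by auto
  then show ?thesis by (cases d) auto
qed

lemma form_weight_measurable [measurable]: "form_weight d \<in> borel_measurable borel"
  unfolding form_weight_def[abs_def] by measurable

interpretation integral: tree_integral lborel form_weight
proof -
  interpret sigma_finite_measure "lborel :: real measure"
    by (rule sigma_finite_lborel)
  show "tree_integral lborel form_weight"
    by unfold_locales simp_all
qed

section \<open>Logarithmic growth of partial integrals\<close>

text \<open>The integral of \<open>1 / (1 - s)\<close> from 0 to \<open>z\<close>; it bounds partial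
  integrals as \<open>harm\<close> bounds partial sums.\<close>

definition log_form :: "real \<Rightarrow> real" where
  "log_form z = - ln (1 - z)"

lemma log_form_mono: "x \<le> y \<Longrightarrow> y < 1 \<Longrightarrow> log_form x \<le> log_form y"
  by (simp add: log_form_def)

lemma log_form_nonneg: "0 \<le> z \<Longrightarrow> z < 1 \<Longrightarrow> 0 \<le> log_form z"
  by (simp add: log_form_def)

lemma log_form_le: "0 \<le> z \<Longrightarrow> z < 1 \<Longrightarrow> log_form z \<le> z / (1 - z)"
  using ln_le_minus_one[of "1 / (1 - z)"] by (simp add: log_form_def ln_div field_simps)

text \<open>Controls both endpoints at once: the factor \<open>z\<close> can cancel the pole of
  \<open>1 / z\<close> at 0, and a large \<open>c\<close> makes the singularity at 1 as weak as
  desired.\<close>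

lemma log_form_le_powr:
  assumes "0 \<le> z" "z < 1" "c \<ge> 1"
  shows "log_form z \<le> c * z * (1 - z) powr (- 1 / c)"
proof -
  define u where "u = (1 - z) powr (1 / c)"
  have "1 - z \<le> u"
    using powr_mono'[of "1 / c" 1 "1 - z"] assms by (simp add: u_def)
  have u: "u > 0" using assms by (simp add: u_def)
  have "log_form z = ln (1 / (1 - z))" using assms by (simp add: log_form_def ln_div)
  also have "\<dots> \<le> c * ((1 / (1 - z)) powr (1 / c) - 1)"
    using assms by (intro ln_le_powr) auto
  also have "\<dots> = c * (1 - u) / u"
    using assms u by (simp add: u_def powr_divide field_simps)
  also have "\<dots> \<le> c * z / u"
    using assms u \<open>1 - z \<le> u\<close> by (intro divide_right_mono mult_left_mono) auto
  also have "\<dots> = c * z * (1 - z) powr (- 1 / c)"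
    by (simp add: u_def powr_minus divide_inverse)
  finally show ?thesis .
qed

lemma nn_integral_log_form:
  assumes "0 \<le> z" "z < 1"
  shows "(\<integral>\<^sup>+s. indicator {..<z} s * form_weight Ly s \<partial>lborel) = ennreal (log_form z)"
proof -
  have "(\<integral>\<^sup>+s. indicator {..<z} s * form_weight Ly s \<partial>lborel) =
      (\<integral>\<^sup>+s. ennreal (1 / (1 - s)) * indicator {0..z} s \<partial>lborel)"
  proof (rule nn_integral_cong_AE)
    show "AE s in lborel. indicator {..<z} s * form_weight Ly s = ennreal (1 / (1 - s)) * indicator {0..z} s"
      using AE_lborel_singleton[of z]
      by eventually_elim (use assms in \<open>auto simp: form_weight_def indicator_def\<close>)
  qed
  also have "\<dots> = ennreal (log_form z - log_form 0)"
    using assms unfolding log_form_def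
    by (intro nn_integral_FTC_Icc) (auto intro!: derivative_eq_intros simp: field_simps)
  finally show ?thesis by (simp add: log_form_def)
qed

text \<open>The form \<open>ds/s\<close> turns one factor \<open>log_form s\<close> into less than \<open>1/(1 - s)\<close>, the density of
  \<open>log_form\<close>; so only the vertices decorated by \<open>y\<close> raise the exponent.\<close>

lemma integral_iint_le_log_form:
  assumes "leaf_labels t \<subseteq> {Ly}"
  shows "\<exists>m\<ge>1. \<forall>z\<in>{0..<1}. integral.iint t {..<z} \<le> ennreal (log_form z) ^ m"
  using assms
proof (induction t)
  case (Node a ts)
  have "\<exists>m\<ge>1. \<forall>z\<in>{0..<1}. integral.iint c {..<z} \<le> ennreal (log_form z) ^ m" if "c \<in> set ts" for c
    using Node that by (cases "ts = []") auto
  from prod_list_le_power[of ts 1 "{0..<1}" "\<lambda>c z. integral.iint c {..<z}", OF this]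
  obtain m where m: "m \<ge> length ts"
    "\<And>z. z \<in> {0..<1} \<Longrightarrow> (\<Prod>c\<leftarrow>ts. integral.iint c {..<z}) \<le> ennreal (log_form z) ^ m"
    by auto
  have pow_mono: "ennreal (log_form s) ^ k \<le> ennreal (log_form z) ^ k" if "s < z" "z < 1" for s z k
    using that by (intro power_mono ennreal_leI log_form_mono) auto
  \<comment> \<open>Common to both letters: a density of at most
    \<open>log_form s ^ k / (1 - s)\<close> adds one logarithm, by monotonicity of
    \<open>log_form\<close>.\<close>
  have *: "integral.iint (Node a ts) {..<z} \<le> ennreal (log_form z) ^ Suc k"
    if z: "z \<in> {0..<1}"
      and density: "\<And>s. s \<in> {0..<1} \<Longrightarrow>
        integral.iint_density (Node a ts) s \<le> form_weight Ly s * ennreal (log_form s) ^ k" for z k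
  proof -
    have "integral.iint (Node a ts) {..<z} \<le>
        (\<integral>\<^sup>+s. (indicator {..<z} s * form_weight Ly s) * ennreal (log_form z) ^ k \<partial>lborel)"
      unfolding integral.iint_eq
    proof (rule nn_integral_mono)
      fix s
      consider "s \<ge> z" | "s < 0" | (inside) "0 \<le> s" "s < z" by linarith
      then show "indicator {..<z} s * integral.iint_density (Node a ts) s \<le>
        indicator {..<z} s * form_weight Ly s * ennreal (log_form z) ^ k"
      proof cases
        case inside
        have "integral.iint_density (Node a ts) s \<le> form_weight Ly s * ennreal (log_form s) ^ k"
          using inside z by (intro density) auto
        also have "\<dots> \<le> form_weight Ly s * ennreal (log_form z) ^ k"
          using inside z by (intro mult_left_mono pow_mono) auto
        finally show ?thesis using inside by simp
      qed (simp_all add: form_weight_def)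
    qed
    also have "\<dots> = ennreal (log_form z) * ennreal (log_form z) ^ k"
      using z by (subst nn_integral_multc) (auto simp: nn_integral_log_form)
    finally show ?thesis by simp
  qed
  show ?case
  proof (cases a)
    case Ly
    have "integral.iint_density (Node a ts) s \<le> form_weight Ly s * ennreal (log_form s) ^ m"
      if "s \<in> {0..<1}" for s
      unfolding integral.iint_density_Node Ly using m(2)[OF that] by (rule mult_left_mono) simp
    from *[OF _ this] show ?thesis by (intro exI[of _ "Suc m"]) auto
  next
    case Lx
    \<comment> \<open>A vertex decorated by \<open>x\<close> is not a leaf, and each child has
      exponent at least 1, so there is a factor \<open>log_form s\<close> to give up.\<close>
    with Node.prems have "ts \<noteq> []" by auto
    then obtain k where k: "m = Suc k" using m(1) by (cases m) auto
    have "integral.iint_density (Node a ts) s \<le> form_weight Ly s * ennreal (log_form s) ^ k"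
      if s: "s \<in> {0..<1}" for s
    proof -
      \<comment> \<open>At \<open>s = 0\<close> the left side is 0 by convention.\<close>
      have "1 / s * log_form s \<le> 1 / (1 - s)"
        using log_form_le[of s] s by (cases "s = 0") (auto simp: field_simps)
      then have "form_weight Lx s * ennreal (log_form s) \<le> form_weight Ly s"
        using s log_form_nonneg[of s]
        by (simp add: form_weight_def ennreal_mult[symmetric] ennreal_leI)
      then have "form_weight Lx s * ennreal (log_form s) * ennreal (log_form s) ^ k \<le>
          form_weight Ly s * ennreal (log_form s) ^ k"
        by (rule mult_right_mono) simp
      moreover have "integral.iint_density (Node a ts) s \<le> form_weight Lx s * ennreal (log_form s) ^ m"
        unfolding integral.iint_density_Node Lx using m(2)[OF s] by (rule mult_left_mono) simp
      ultimately show ?thesis by (simp add: k mult.assoc)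
    qed
    from *[OF _ this] show ?thesis by (intro exI[of _ "Suc k"]) auto
  qed
qed

text \<open>The antiderivative \<open>- 2 * sqrt (1 - s)\<close> is continuous up to 1, though
  differentiable only before it.\<close>

lemma nn_integral_inverse_sqrt:
  "(\<integral>\<^sup>+s. ennreal (1 / sqrt (1 - s) * indicator {0..1} s) \<partial>lborel) < top"
proof -
  have "((\<lambda>s. 1 / sqrt (1 - s)) has_integral (- 2 * sqrt (1 - 1) - - 2 * sqrt (1 - 0))) {0..1}"
    by (rule fundamental_theorem_of_calculus_interior)
      (auto intro!: continuous_intros derivative_eq_intros
        simp: has_real_derivative_iff_has_vector_derivative[symmetric] field_simps)
  moreover have eq: "(\<lambda>s. 1 / sqrt (1 - s) * indicator {0..1} s) =
      (\<lambda>s. if s \<in> {0..1} then 1 / sqrt (1 - s) else 0 :: real)"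
    by (auto simp: indicator_def)
  ultimately have "((\<lambda>s. 1 / sqrt (1 - s) * indicator {0..1} s) has_integral (2 :: real)) UNIV"
    unfolding eq has_integral_restrict_UNIV by simp
  then have "(\<integral>\<^sup>+s. ennreal (1 / sqrt (1 - s) * indicator {0..1} s) \<partial>lborel) = ennreal 2"
    by (intro nn_integral_has_integral_lborel) (auto simp: indicator_def)
  then show ?thesis by simp
qed

text \<open>The root form \<open>ds/s\<close> is harmless at 0 because the root has children, whose
  logarithmic bound vanishes there; at 1 a power of the logarithm is dominated by an inverse square
  root.\<close>

lemma integral_iint_finite:
  assumes "t \<in> conv_trees_letter"
  shows "integral.iint t UNIV < top"
proof (cases t)
  case (Node a ts)
  have a: "a = Lx" and leaves: "leaf_labels (Node a ts) \<subseteq> {Ly}"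
    using assms by (auto simp: conv_trees_letter_eq Node simp del: leaf_labels.simps)
  then have ts: "ts \<noteq> []" by auto
  have "\<exists>m\<ge>1. \<forall>z\<in>{0..<1}. integral.iint c {..<z} \<le> ennreal (log_form z) ^ m" if "c \<in> set ts" for c
    by (rule integral_iint_le_log_form) (use leaves ts that in \<open>simp, blast\<close>)
  from prod_list_le_power[of ts 1 "{0..<1}" "\<lambda>c z. integral.iint c {..<z}", OF this]
  obtain m where "m \<ge> length ts" and m:
    "\<And>z. z \<in> {0..<1} \<Longrightarrow> (\<Prod>c\<leftarrow>ts. integral.iint c {..<z}) \<le> ennreal (log_form z) ^ m"
    by auto
  then have m1: "m \<ge> 1" using ts by (cases ts) auto
  \<comment> \<open>With this choice the \<open>m\<close>-th power of
    \<open>(1 - s) powr (- 1 / c)\<close> is \<open>1 / sqrt (1 - s)\<close>.\<close>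
  define c where "c = 2 * real m"
  have c: "c \<ge> 1" "real m / c = 1 / 2" using m1 by (auto simp: c_def field_simps)
  have bound: "1 / s * log_form s ^ m \<le> c ^ m * (1 / sqrt (1 - s))" if s: "0 \<le> s" "s < 1" for s
  proof (cases "s = 0")
    case False
    have "log_form s ^ m \<le> (c * s * (1 - s) powr (- 1 / c)) ^ m"
      using s c by (intro power_mono log_form_le_powr log_form_nonneg)
    also have "\<dots> = c ^ m * s ^ m * (1 - s) powr (- (real m / c))"
      using s by (simp add: power_mult_distrib powr_power)
    also have "(1 - s) powr (- (real m / c)) = 1 / sqrt (1 - s)"
      unfolding c(2) powr_minus using s by (simp add: powr_half_sqrt inverse_eq_divide)
    \<comment> \<open>As \<open>m \<ge> 1\<close>, one factor \<open>s\<close> can be kept to cancel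
      \<open>1 / s\<close>.\<close>
    also have "c ^ m * s ^ m * (1 / sqrt (1 - s)) \<le> c ^ m * s * (1 / sqrt (1 - s))"
      using s c m1 power_decreasing[of 1 m s] by (intro mult_right_mono mult_left_mono) auto
    finally show ?thesis using s False by (simp add: field_simps)
  qed (use c in simp)
  have "integral.iint t UNIV \<le> (\<integral>\<^sup>+s. ennreal (c ^ m) * ennreal (1 / sqrt (1 - s) * indicator {0..1} s) \<partial>lborel)"
    unfolding integral.iint_eq
  proof (rule nn_integral_mono_AE)
    \<comment> \<open>The endpoint 1 is discarded as a null set: the bounds for the children hold
      only before it, and the majorant takes the value 0 there by convention.\<close>
    show "AE s in lborel. indicator UNIV s * integral.iint_density t s \<le>
        ennreal (c ^ m) * ennreal (1 / sqrt (1 - s) * indicator {0..1} s)"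
      using AE_lborel_singleton[of 1]
    proof eventually_elim
      case (elim s)
      show ?case
      proof (cases "s \<in> {0..<1}")
        case True
        have "integral.iint_density t s \<le> ennreal (1 / s) * ennreal (log_form s) ^ m"
          using True m[OF True] by (simp add: Node a form_weight_def mult_left_mono)
        also have "\<dots> = ennreal (1 / s * log_form s ^ m)"
          using True log_form_nonneg[of s] by (subst ennreal_power, simp, subst ennreal_mult[symmetric]) auto
        also have "\<dots> \<le> ennreal (c ^ m * (1 / sqrt (1 - s)))"
          using True by (intro ennreal_leI bound) auto
        also have "\<dots> = ennreal (c ^ m) * ennreal (1 / sqrt (1 - s) * indicator {0..1} s)"
          using True c by (subst ennreal_mult[symmetric]) auto
        finally show ?thesis by simp
      next
        case False
        then show ?thesis using elim by (auto simp: Node form_weight_def)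
      qed
    qed
  qed
  also have "\<dots> = ennreal (c ^ m) * (\<integral>\<^sup>+s. ennreal (1 / sqrt (1 - s) * indicator {0..1} s) \<partial>lborel)"
    by (rule nn_integral_cmult) simp
  also have "\<dots> < top"
    using nn_integral_inverse_sqrt by (simp add: ennreal_mult_less_top)
  finally show ?thesis .
qed

text \<open>On the simplex all densities are nonnegative, so the Lebesgue integral is the real value
  of the extended nonnegative one; a divergent integral gives 0 on both sides.\<close>

lemma zeta_sh_tree_eq_iint: "zeta_sh_tree t = enn2real (integral.iint t UNIV)"
proof -
  let ?P = "Pi\<^sub>M (verts t) (\<lambda>_. lborel :: real measure)"
  let ?f = "\<lambda>z. \<Prod>v\<in>verts t. form_density (deco t v) (z v)"
  have density_nonneg: "0 \<le> form_density d \<tau>" if "\<tau> \<in> {0..1}" for d \<tau>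
    using that by (cases d) auto
  have weight: "integral.weight t z = ennreal (indicator (tree_simplex t) z * ?f z)"
    and nonneg: "0 \<le> indicator (tree_simplex t) z * ?f z"
    if "z \<in> space ?P" for z
  proof -
    have "integral.weight t z = ennreal (indicator (tree_simplex t) z * ?f z) \<and>
      0 \<le> indicator (tree_simplex t) z * ?f z"
    proof (cases "\<forall>v\<in>verts t. z v \<in> {0..1}")
      case True
      have "(\<Prod>v\<in>verts t. form_weight (deco t v) (z v)) = (\<Prod>v\<in>verts t. ennreal (form_density (deco t v) (z v)))"
        using True by (intro prod.cong) (auto simp: form_weight_def)
      also have "\<dots> = ennreal (?f z)"
        using True by (intro prod_ennreal density_nonneg) auto
      finally have "(\<Prod>v\<in>verts t. form_weight (deco t v) (z v)) = ennreal (?f z)" .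
      moreover have "z \<in> tree_simplex t \<longleftrightarrow> integral.decreasing t z"
        using True that by (auto simp: tree_simplex_def integral.decreasing_def space_PiM PiE_iff)
      moreover have "0 \<le> ?f z" using True by (intro prod_nonneg density_nonneg) auto
      ultimately show ?thesis by (simp add: integral.weight_def indicator_def)
    next
      case False
      then have "(\<Prod>v\<in>verts t. form_weight (deco t v) (z v)) = 0"
        by (intro prod_zero) (auto simp: form_weight_def indicator_def)
      moreover have "z \<notin> tree_simplex t" using False by (auto simp: tree_simplex_def PiE_iff)
      ultimately show ?thesis by (simp add: integral.weight_def)
    qed
    then show "integral.weight t z = ennreal (indicator (tree_simplex t) z * ?f z)"
      and "0 \<le> indicator (tree_simplex t) z * ?f z" by auto
  qed
  \<comment> \<open>Measurability of the real integrand is inherited from \<open>weight\<close>,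
    with which it agrees on the space.\<close>
  have "(\<lambda>z. enn2real (integral.weight t z)) \<in> borel_measurable ?P"
    by measurable
  then have meas: "(\<lambda>z. indicator (tree_simplex t) z * ?f z) \<in> borel_measurable ?P"
    by (rule measurable_cong[THEN iffD1, rotated]) (simp add: weight nonneg)
  have "zeta_sh_tree t = integral\<^sup>L ?P (\<lambda>z. indicator (tree_simplex t) z * ?f z)"
    by (simp add: zeta_sh_tree_def set_lebesgue_integral_def)
  also have "\<dots> = enn2real (\<integral>\<^sup>+z. ennreal (indicator (tree_simplex t) z * ?f z) \<partial>?P)"
    using meas nonneg by (intro integral_eq_nn_integral AE_I2) auto
  also have "(\<integral>\<^sup>+z. ennreal (indicator (tree_simplex t) z * ?f z) \<partial>?P) = integral.iint t UNIV"
    unfolding integral.nn_integral_weight_UNIV[symmetric] by (intro nn_integral_cong weight[symmetric])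
  finally show ?thesis .
qed

lemma sum_zeta_sh_tree_star_list:
  assumes "s \<in> conv_trees_letter" "t \<in> conv_trees_letter"
  shows "(\<Sum>u\<leftarrow>star_list None s t. zeta_sh_tree u) = zeta_sh_tree s * zeta_sh_tree t"
  unfolding zeta_sh_tree_eq_iint
  by (intro integral.enn2real_iint_star_list integral_iint_finite assms) auto

theorem theorem31:
  fixes K :: "real set"
  assumes "real_subfield K"
  shows "algebra_morphism K (tree_span K conv_trees_letter) shT zeta_shT \<and>
         algebra_morphism K (tree_span K conv_trees_nat) qshT zetaT"
proof
  show "algebra_morphism K (tree_span K conv_trees_letter) shT zeta_shT"
    unfolding shT_def zeta_shT_def
    by (intro algebra_morphism_tree_star assms star_list_conv_trees_letter sum_zeta_sh_tree_star_list)
  show "algebra_morphism K (tree_span K conv_trees_nat) qshT zetaT"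
    unfolding qshT_def zetaT_def
    by (intro algebra_morphism_tree_star assms star_list_conv_trees_nat sum_zeta_tree_star_list)
qed

end
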